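(* In the Lobachevsky (hyperbolic) 3-space $\mathbb{H}^3$ there exist a polyhedron $\mathscr{S}$ that is homeomorphic to a sphere and free of self-intersections, and an infinitesimal flex $\mathscr{S}(t)$, $t\in(-1,1)$, of $\mathscr{S}$, such that the volume bounded by $\mathscr{S}$ is not stationary under this flex; that is, if $V(t)$ denotes the volume bounded by $\mathscr{S}(t)$, then $\frac{dV}{dt}(0)\neq 0$.
   Context: The Lobachevsky 3-space $\mathbb{H}^3$ has curvature $-1$. A polyhedron means a polyhedral surface. A deformation of a polyhedral surface $\mathscr{S}$ is a family of surfaces $\mathscr{S}(t)$, $t\in(-1,1)$, which depends analytically on the parameter $t$, preserves the combinatorial structure of $\mathscr{S}$, and satisfies $\mathscr{S}(0)=\mathscr{S}$. A quantity depending on $t$ is called stationary (at $t=0$) if its derivative with respect to $t$ vanishes at $t=0$. A deformation $\mathscr{S}(t)$ of a polyhedral surface $\mathscr{S}$ with triangular faces is called an infinitesimal flex of $\mathscr{S}$ if the lengths of all edges of $\mathscr{S}(t)$ are stationary at $t=0$. *)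

theory Defs
  imports "HOL-Analysis.Analysis"
begin

(* Hyperbolic 3-space of curvature -1 in the projective (Cayley-Klein) model: the point x of the
   open unit ball stands for (1,x) / sqrt (1 - |x|^2) on the hyperboloid -X0^2 + |X|^2 = -1.
   Hyperbolic lines and planes are the chords and plane sections of the ball, so the hyperbolic
   triangle spanned by three points of the model is their Euclidean convex hull. *)

definition klein_ball :: "(real^3) set" where
  "klein_ball = ball 0 1"

(* cosh d = - <X,Y> for the Lorentzian product of the corresponding points of the hyperboloid. *)

definition hyp_dist :: "real^3 \<Rightarrow> real^3 \<Rightarrow> real" where
  "hyp_dist x y = arcosh ((1 - x \<bullet> y) / sqrt ((1 - (norm x)\<^sup>2) * (1 - (norm y)\<^sup>2)))"

(* The Riemannian metric in this model is
     g_x(v,v) = |v|^2 / (1 - |x|^2) + (x . v)^2 / (1 - |x|^2)^2,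
   whose determinant is (1 - |x|^2)^(-4). *)

definition hyp_measure :: "(real^3) measure" where
  "hyp_measure =
     density lborel (\<lambda>x. ennreal (indicator klein_ball x / (1 - (norm x)\<^sup>2)\<^sup>2))"

definition hyp_volume :: "(real^3) set \<Rightarrow> real" where
  "hyp_volume A = measure hyp_measure A"

(* A polyhedral surface with triangular faces is given by its combinatorial structure F, the set of
   vertex triples of the faces, and the positions p of the vertices; it may intersect itself.
   Faces are genuine triangles and edges are genuine edges: adjacent faces are not coplanar, which
   excludes artificial subdivisions of flat faces. *)

definition polyhedral_surface :: "nat set set \<Rightarrow> (nat \<Rightarrow> real^3) \<Rightarrow> bool" where
  "polyhedral_surface F p \<longleftrightarrow>
     finite F \<and>
     (\<forall>A\<in>F. card A = 3 \<and> p ` A \<subseteq> klein_ball \<and> aff_dim (p ` A) = 2) \<and>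
     (\<forall>A\<in>F. \<forall>B\<in>F. card (A \<inter> B) = 2 \<longrightarrow> aff_dim (p ` (A \<union> B)) = 3)"

definition edge :: "nat set set \<Rightarrow> nat \<Rightarrow> nat \<Rightarrow> bool" where
  "edge F u v \<longleftrightarrow> u \<noteq> v \<and> (\<exists>A\<in>F. u \<in> A \<and> v \<in> A)"

definition surface_points :: "nat set set \<Rightarrow> (nat \<Rightarrow> real^3) \<Rightarrow> (real^3) set" where
  "surface_points F p = (\<Union>A\<in>F. convex hull (p ` A))"

(* Two faces meet exactly in the vertex, edge or empty set they have in common combinatorially. *)

definition no_self_intersections :: "nat set set \<Rightarrow> (nat \<Rightarrow> real^3) \<Rightarrow> bool" where
  "no_self_intersections F p \<longleftrightarrow>
     (\<forall>A\<in>F. \<forall>B\<in>F.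
        convex hull (p ` A) \<inter> convex hull (p ` B) = convex hull (p ` (A \<inter> B)))"

definition homeomorphic_to_sphere :: "nat set set \<Rightarrow> (nat \<Rightarrow> real^3) \<Rightarrow> bool" where
  "homeomorphic_to_sphere F p \<longleftrightarrow> surface_points F p homeomorphic (sphere 0 1 :: (real^3) set)"

definition real_analytic_on :: "(real \<Rightarrow> 'a::real_normed_vector) \<Rightarrow> real set \<Rightarrow> bool" where
  "real_analytic_on f S \<longleftrightarrow>
     (\<forall>s\<in>S. \<exists>r>0. \<exists>a :: nat \<Rightarrow> 'a.
        \<forall>t. \<bar>t - s\<bar> < r \<longrightarrow> (\<lambda>n. (t - s) ^ n *\<^sub>R a n) sums f t)"

definition deformation ::
    "nat set set \<Rightarrow> (nat \<Rightarrow> real^3) \<Rightarrow> (real \<Rightarrow> nat \<Rightarrow> real^3) \<Rightarrow> bool" where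
  "deformation F p P \<longleftrightarrow>
     (\<forall>v\<in>\<Union>F. P 0 v = p v \<and> real_analytic_on (\<lambda>t. P t v) {-1<..<1}) \<and>
     (\<forall>t\<in>{-1<..<1}. polyhedral_surface F (P t))"

definition stationary :: "(real \<Rightarrow> real) \<Rightarrow> bool" where
  "stationary f \<longleftrightarrow> (f has_real_derivative 0) (at 0)"

definition infinitesimal_flex ::
    "nat set set \<Rightarrow> (nat \<Rightarrow> real^3) \<Rightarrow> (real \<Rightarrow> nat \<Rightarrow> real^3) \<Rightarrow> bool" where
  "infinitesimal_flex F p P \<longleftrightarrow>
     deformation F p P \<and>
     (\<forall>u v. edge F u v \<longrightarrow> stationary (\<lambda>t. hyp_dist (P t u) (P t v)))"

(* The volume of the union of the bounded components of the complement. If the surface at t = 0 is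
   embedded then so are the surfaces at all small t, so the derivative at 0 of this volume along a
   deformation involves embedded surfaces only. *)

definition bounded_volume :: "nat set set \<Rightarrow> (nat \<Rightarrow> real^3) \<Rightarrow> real" where
  "bounded_volume F p = hyp_volume (inside (surface_points F p))"

end

theory Submission
  imports Defs
begin

text \<open>The surface is an octahedron \<open>S\<close> of Schoenhardt's type: a triangular antiprism, twisted until it
  becomes infinitesimally flexible. In the Klein model it is the image of the standard octahedron
  under a map that is linear on every orthant. When the eight orthants have images of the same
  orientation, this map is injective, which makes \<open>S\<close> an embedded sphere that bounds the image of
  the open octahedron, and the enclosed volume is a sum of eight integrals over the standard simplex.

  If a flex does not increase the distances of the vertices to the origin then, the edges being
  stationary, it does not increase the inner products of adjacent vertices either, so that no point
  of the surface moves away from the origin, where the hyperbolic volume density is smallest.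
  As the Euclidean volumes of the eight tetrahedra do not increase either, and not all of them are
  stationary, the derivative of the volume is negative.\<close>

text \<open>The volume of a hyperbolic tetrahedron is not an elementary function of its vertices, so
  no volume is evaluated: only the sign of a derivative is established, and it is reduced to the
  signs of finitely many rational numbers. Adding an infinitesimal isometry to a flex changes
  neither the stationarity of the edges nor the derivative of the volume; this freedom is spent on
  giving all contributions the same sign. The vertices move along straight lines of the model with
  constant velocity, which suffices because only first derivatives at 0 matter. Integrating over a
  fixed simplex leaves the parameter in the integrand alone, where it can be differentiated.
  Embeddedness and nondegeneracy come from open conditions on the vertices, so they persist for
  small parameters, and rescaling the velocity makes the motion fit the interval (-1,1).\<close>

section \<open>Piecewise linear maps of the octahedron\<close>

text \<open>The determinant with rows \<open>u\<close>, \<open>v\<close>, \<open>w\<close>. As an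
  explicit polynomial it is multilinear by plain algebra and can be evaluated at concrete
  vertices.\<close>

definition triple :: "real^3 \<Rightarrow> real^3 \<Rightarrow> real^3 \<Rightarrow> real" where
  "triple u v w = u$1 * (v$2 * w$3 - v$3 * w$2) - u$2 * (v$1 * w$3 - v$3 * w$1)
     + u$3 * (v$1 * w$2 - v$2 * w$1)"

text \<open>Cramer's rule: as the triple product is alternating, putting the combination in place of
  one vector multiplies it by the corresponding coefficient.\<close>

lemma triple_nonzero_imp_independent:
  assumes "triple u v w \<noteq> 0" and "a *\<^sub>R u + b *\<^sub>R v + c *\<^sub>R w = 0"
  shows "a = 0 \<and> b = 0 \<and> c = 0"
proof -
  let ?z = "a *\<^sub>R u + b *\<^sub>R v + c *\<^sub>R w"
  have "triple ?z v w = a * triple u v w" "triple u ?z w = b * triple u v w"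
    "triple u v ?z = c * triple u v w"
    by (simp_all add: triple_def algebra_simps)
  moreover have "triple 0 v w = 0" "triple u 0 w = 0" "triple u v 0 = 0"
    by (simp_all add: triple_def)
  ultimately have "a * triple u v w = 0" "b * triple u v w = 0" "c * triple u v w = 0"
    using assms(2) by metis+
  then show ?thesis
    using assms(1) by simp
qed

lemma triple_convex_combinations_pos:
  assumes "0 \<le> a" "a \<le> 1" "0 \<le> b" "b \<le> 1" "0 \<le> c" "c \<le> 1"
    and "triple u v w > 0" "triple u v w' > 0" "triple u v' w > 0" "triple u v' w' > 0"
      "triple u' v w > 0" "triple u' v w' > 0" "triple u' v' w > 0" "triple u' v' w' > 0"
  shows "triple (a *\<^sub>R u + (1 - a) *\<^sub>R u') (b *\<^sub>R v + (1 - b) *\<^sub>R v') (c *\<^sub>R w + (1 - c) *\<^sub>R w') > 0"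
proof -
  have comb: "s * x + (1 - s) * y > 0" if "0 \<le> s" "s \<le> 1" "x > 0" "y > 0" for s x y :: real
    using that by (cases "s = 0") (auto intro!: add_pos_nonneg)
  have lin: "triple (a *\<^sub>R u + (1 - a) *\<^sub>R u') x y = a * triple u x y + (1 - a) * triple u' x y"
    "triple x (b *\<^sub>R v + (1 - b) *\<^sub>R v') y = b * triple x v y + (1 - b) * triple x v' y"
    "triple x y (c *\<^sub>R w + (1 - c) *\<^sub>R w') = c * triple x y w + (1 - c) * triple x y w'" for x y
    by (simp_all add: triple_def algebra_simps)
  show ?thesis
    unfolding lin by (intro comb assms)
qed

text \<open>The vertices \<open>v\<close> and \<open>v + 3\<close> are opposite: vertex \<open>v < 3\<close> of an octahedron corresponds to the
  \<open>v\<close>-th unit vector (counted from 0) and \<open>v + 3\<close> to its negative.\<close>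

definition orthant_coord :: "real^3 \<Rightarrow> nat \<Rightarrow> real" where
  "orthant_coord x v =
     (if v = 0 then max 0 (x$1) else if v = 1 then max 0 (x$2) else if v = 2 then max 0 (x$3)
      else if v = 3 then max 0 (- x$1) else if v = 4 then max 0 (- x$2)
      else if v = 5 then max 0 (- x$3) else 0)"

definition pl_map :: "(nat \<Rightarrow> real^3) \<Rightarrow> real^3 \<Rightarrow> real^3" where
  "pl_map p x = (\<Sum>v<6. orthant_coord x v *\<^sub>R p v)"

definition l1_norm :: "real^3 \<Rightarrow> real" where
  "l1_norm x = \<bar>x$1\<bar> + \<bar>x$2\<bar> + \<bar>x$3\<bar>"

text \<open>On the half space where the first coordinate is negative, the linear piece of
  \<open>pl_map p\<close> sends the first unit vector to \<open>- p 3\<close>, and likewise for the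
  others. Hence the eight numbers are the determinants of the linear pieces.\<close>

definition positively_oriented :: "(nat \<Rightarrow> real^3) \<Rightarrow> bool" where
  "positively_oriented p \<longleftrightarrow>
     (\<forall>u\<in>{p 0, - p 3}. \<forall>v\<in>{p 1, - p 4}. \<forall>w\<in>{p 2, - p 5}. triple u v w > 0)"

lemma sum_lessThan_6:
  fixes f :: "nat \<Rightarrow> 'a::comm_monoid_add"
  shows "(\<Sum>v<6. f v) = f 0 + f 1 + f 2 + f 3 + f 4 + f 5"
  by (simp add: eval_nat_numeral add.assoc)

lemma pl_map_alt:
  "pl_map p x = max 0 (x$1) *\<^sub>R p 0 + max 0 (x$2) *\<^sub>R p 1 + max 0 (x$3) *\<^sub>R p 2
     + max 0 (- x$1) *\<^sub>R p 3 + max 0 (- x$2) *\<^sub>R p 4 + max 0 (- x$3) *\<^sub>R p 5"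
  by (simp add: pl_map_def sum_lessThan_6 orthant_coord_def)

text \<open>\<open>s\<close> is the secant slope of the positive part. The negative part has secant
  slope \<open>s - 1\<close>, because the difference of the two parts is the identity.\<close>

lemma positive_part_diff:
  fixes x y :: real
  obtains s where "0 \<le> s" "s \<le> 1" "max 0 x - max 0 y = (x - y) * s"
    "max 0 (- x) - max 0 (- y) = - ((x - y) * (1 - s))"
proof (cases "x = y")
  case True
  then show ?thesis using that[of 0] by simp
next
  case False
  define s where "s = (max 0 x - max 0 y) / (x - y)"
  have "0 \<le> s" "s \<le> 1"
    using False by (auto simp: s_def max_def field_simps divide_simps)
  moreover have e: "max 0 x - max 0 y = (x - y) * s"
    using False by (simp add: s_def)
  moreover have "max 0 (- x) - max 0 (- y) = - ((x - y) * (1 - s))"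
    unfolding right_diff_distrib e[symmetric] by (auto simp: max_def)
  ultimately show ?thesis using that by blast
qed

text \<open>A difference of values of the piecewise linear map is a combination of three vectors
  \<open>q\<^sub>i\<close> of the segments from \<open>p\<^sub>i\<close> to \<open>- p\<^bsub>i+3\<^esub>\<close>, and the triple product, being multilinear, is
  positive on such vectors as soon as it is positive at the ends of the segments.\<close>

lemma inj_pl_map:
  assumes "positively_oriented p"
  shows "inj (pl_map p)"
proof (rule injI)
  fix x y assume eq: "pl_map p x = pl_map p y"
  obtain a where a: "0 \<le> a" "a \<le> 1" "max 0 (x$1) - max 0 (y$1) = (x$1 - y$1) * a"
    "max 0 (- x$1) - max 0 (- y$1) = - ((x$1 - y$1) * (1 - a))"
    by (rule positive_part_diff)
  obtain b where b: "0 \<le> b" "b \<le> 1" "max 0 (x$2) - max 0 (y$2) = (x$2 - y$2) * b"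
    "max 0 (- x$2) - max 0 (- y$2) = - ((x$2 - y$2) * (1 - b))"
    by (rule positive_part_diff)
  obtain c where c: "0 \<le> c" "c \<le> 1" "max 0 (x$3) - max 0 (y$3) = (x$3 - y$3) * c"
    "max 0 (- x$3) - max 0 (- y$3) = - ((x$3 - y$3) * (1 - c))"
    by (rule positive_part_diff)
  let ?q1 = "a *\<^sub>R p 0 + (1 - a) *\<^sub>R (- p 3)" and ?q2 = "b *\<^sub>R p 1 + (1 - b) *\<^sub>R (- p 4)"
    and ?q3 = "c *\<^sub>R p 2 + (1 - c) *\<^sub>R (- p 5)"
  have "0 = pl_map p x - pl_map p y"
    using eq by simp
  also have "\<dots> = (max 0 (x$1) - max 0 (y$1)) *\<^sub>R p 0 + (max 0 (- x$1) - max 0 (- y$1)) *\<^sub>R p 3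
      + ((max 0 (x$2) - max 0 (y$2)) *\<^sub>R p 1 + (max 0 (- x$2) - max 0 (- y$2)) *\<^sub>R p 4)
      + ((max 0 (x$3) - max 0 (y$3)) *\<^sub>R p 2 + (max 0 (- x$3) - max 0 (- y$3)) *\<^sub>R p 5)"
    unfolding pl_map_alt by (simp add: scaleR_left_diff_distrib)
  also have "\<dots> = (x$1 - y$1) *\<^sub>R ?q1 + (x$2 - y$2) *\<^sub>R ?q2 + (x$3 - y$3) *\<^sub>R ?q3"
    unfolding a b c by (simp add: algebra_simps)
  finally have "(x$1 - y$1) *\<^sub>R ?q1 + (x$2 - y$2) *\<^sub>R ?q2 + (x$3 - y$3) *\<^sub>R ?q3 = 0" ..
  moreover have "triple ?q1 ?q2 ?q3 > 0"
    using assms unfolding positively_oriented_def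
    by (intro triple_convex_combinations_pos a b c) auto
  ultimately have "x$1 - y$1 = 0 \<and> x$2 - y$2 = 0 \<and> x$3 - y$3 = 0"
    by (intro triple_nonzero_imp_independent) auto
  then show "x = y"
    by (simp add: vec_eq_iff forall_3)
qed

lemma continuous_on_pl_map: "continuous_on S (pl_map p)"
  unfolding pl_map_alt by (intro continuous_intros)

section \<open>The standard octahedron as the unit ball of the l1 norm\<close>

lemma continuous_on_l1_norm: "continuous_on S l1_norm"
  unfolding l1_norm_def by (intro continuous_intros)

lemma l1_norm_eq_sum: "l1_norm x = (\<Sum>v<6. orthant_coord x v)"
  by (simp add: l1_norm_def sum_lessThan_6 orthant_coord_def max_def)

lemma orthant_coord_nonneg: "0 \<le> orthant_coord x v"
  by (simp add: orthant_coord_def)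

lemma norm_le_l1_norm: "norm x \<le> l1_norm x"
  using norm_le_l1_cart[of x] by (simp add: l1_norm_def sum_3)

lemma l1_norm_scaleR: "l1_norm (c *\<^sub>R x) = \<bar>c\<bar> * l1_norm x"
  by (simp add: l1_norm_def abs_mult algebra_simps)

lemma l1_norm_triangle: "l1_norm (x + y) \<le> l1_norm x + l1_norm y"
  unfolding l1_norm_def vector_add_component by linarith

lemma l1_norm_pos: "x \<noteq> 0 \<Longrightarrow> 0 < l1_norm x"
  using norm_le_l1_norm[of x] by (metis less_le_trans zero_less_norm_iff)

lemma convex_l1_ball: "convex {x. l1_norm x \<le> r}"
proof (rule convexI; clarsimp)
  fix x y and u v :: real
  assume h: "l1_norm x \<le> r" "l1_norm y \<le> r" "0 \<le> u" "0 \<le> v" "u + v = 1"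
  have "l1_norm (u *\<^sub>R x + v *\<^sub>R y) \<le> u * l1_norm x + v * l1_norm y"
    using l1_norm_triangle[of "u *\<^sub>R x" "v *\<^sub>R y"] h by (simp add: l1_norm_scaleR)
  then show "l1_norm (u *\<^sub>R x + v *\<^sub>R y) \<le> r"
    using h convex_bound_le[of "l1_norm x" r "l1_norm y" u v] by linarith
qed

lemma bounded_l1_ball: "bounded {x. l1_norm x \<le> r}"
  by (rule bounded_subset[OF bounded_cball[of 0 r]]) (auto intro: order_trans[OF norm_le_l1_norm])

lemma compact_l1_ball: "compact {x. l1_norm x \<le> r}"
  by (simp add: compact_eq_bounded_closed bounded_l1_ball closed_Collect_le continuous_on_l1_norm)

lemma open_l1_ball: "open {x. l1_norm x < r}"
  by (intro open_Collect_less continuous_on_l1_norm continuous_intros)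

lemma compact_l1_sphere: "compact {x. l1_norm x = 1}"
proof -
  have "closed {x. l1_norm x = 1}"
    by (intro closed_Collect_eq continuous_on_l1_norm continuous_intros)
  moreover have "bounded {x. l1_norm x = 1}"
    by (rule bounded_subset[OF bounded_l1_ball[of 1]]) auto
  ultimately show ?thesis by (simp add: compact_eq_bounded_closed)
qed

text \<open>Radial projection; a point of the round sphere is hit after division by its l1
  norm.\<close>

lemma l1_sphere_homeomorphic_sphere: "{x. l1_norm x = 1} homeomorphic (sphere 0 1 :: (real^3) set)"
proof (rule homeomorphic_compact[OF compact_l1_sphere])
  let ?f = "\<lambda>x :: real^3. (1 / norm x) *\<^sub>R x"
  have nz: "x \<noteq> 0" if "l1_norm x = 1" for x using that by (auto simp: l1_norm_def)
  show "continuous_on {x. l1_norm x = 1} ?f"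
    using nz by (intro continuous_intros) auto
  show "?f ` {x. l1_norm x = 1} = sphere 0 1"
  proof (intro equalityI subsetI)
    fix y :: "real^3" assume "y \<in> sphere 0 1"
    then have y: "norm y = 1" "y \<noteq> 0" by auto
    then have p: "l1_norm y > 0" by (simp add: l1_norm_pos)
    show "y \<in> ?f ` {x. l1_norm x = 1}"
      by (rule image_eqI[of _ _ "(1 / l1_norm y) *\<^sub>R y"]) (use p y in \<open>auto simp: l1_norm_scaleR\<close>)
  qed (use nz in auto)
  show "inj_on ?f {x. l1_norm x = 1}"
  proof (rule inj_onI)
    fix x y assume h: "x \<in> {x. l1_norm x = 1}" "y \<in> {x. l1_norm x = 1}" "?f x = ?f y"
    then have n: "norm x > 0" "norm y > 0" using nz by auto
    have "l1_norm (?f x) = 1 / norm x" "l1_norm (?f y) = 1 / norm y"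
      using h(1,2) n by (simp_all add: l1_norm_scaleR)
    then have "norm x = norm y" using h(3) n by (metis divide_inverse inverse_eq_imp_eq mult_1)
    then show "x = y" using h n by simp
  qed
qed

text \<open>The exterior is connected and unbounded, so it lies in no bounded component of the
  complement of \<open>S\<close>. Conversely, \<open>U\<close> and the exterior are disjoint open
  sets that cover this complement, so a component that meets \<open>U\<close> cannot leave
  it.\<close>

lemma inside_eqI:
  fixes S U :: "'a::real_normed_vector set"
  assumes U: "open U" "bounded U" "U \<inter> S = {}"
    and US: "closed (U \<union> S)" "connected (- (U \<union> S))" "\<not> bounded (- (U \<union> S))"
  shows "inside S = U"
proof (intro equalityI subsetI)
  fix x assume "x \<in> inside S"
  then have x: "x \<notin> S" "bounded (connected_component_set (- S) x)"
    by (auto simp: inside_def)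
  have "- (U \<union> S) \<subseteq> connected_component_set (- S) x" if "x \<in> - (U \<union> S)"
    by (rule connected_component_maximal[OF that US(2)]) blast
  then show "x \<in> U" using x US(3) bounded_subset by blast
next
  fix x assume x: "x \<in> U"
  let ?C = "connected_component_set (- S) x"
  have xS: "x \<notin> S" using x U by blast
  have CS: "?C \<subseteq> - S" by (rule connected_component_subset)
  have "?C \<subseteq> U"
  proof (rule ccontr)
    assume "\<not> ?C \<subseteq> U"
    then have "- (U \<union> S) \<inter> ?C \<noteq> {}" using CS by blast
    moreover have "U \<inter> ?C \<noteq> {}" using x xS by (metis ComplI IntI connected_component_refl_eq emptyE mem_Collect_eq)
    moreover have "?C \<subseteq> U \<union> - (U \<union> S)" using CS by blast
    moreover have "open (- (U \<union> S))" using US by blast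
    moreover have "U \<inter> - (U \<union> S) \<inter> ?C = {}" by blast
    ultimately show False
      using connectedD[OF connected_connected_component[of "- S" x] U(1)] by metis
  qed
  then show "x \<in> inside S" using xS bounded_subset[OF U(2)] by (simp add: inside_def)
qed

text \<open>Invariance of domain makes the image of the open ball open, and the complement of a
  homeomorphic copy of a compact convex set is connected in dimension at least 2. So the inside is
  found without the full Jordan-Brouwer theorem.\<close>

lemma inside_pl_map_l1_sphere:
  assumes "positively_oriented p"
  shows "inside (pl_map p ` {x. l1_norm x = 1}) = pl_map p ` {x. l1_norm x < 1}"
proof -
  let ?f = "pl_map p"
  let ?B = "?f ` {x. l1_norm x \<le> 1}"
  note inj = inj_pl_map[OF assms]
  have "{x. l1_norm x \<le> 1} = {x. l1_norm x < 1} \<union> {x. l1_norm x = 1}" by auto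
  then have B: "?f ` {x. l1_norm x < 1} \<union> ?f ` {x. l1_norm x = 1} = ?B"
    by (simp only: image_Un)
  have cB: "compact ?B"
    by (intro compact_continuous_image continuous_on_pl_map compact_l1_ball)
  have hom: "{x. l1_norm x \<le> 1} homeomorphic ?B"
    by (rule homeomorphic_compact[OF compact_l1_ball continuous_on_pl_map refl])
      (rule inj_on_subset[OF inj subset_UNIV])
  show ?thesis
  proof (rule inside_eqI; (unfold B)?)
    show "open (?f ` {x. l1_norm x < 1})"
      by (intro invariance_of_domain continuous_on_pl_map open_l1_ball inj_on_subset[OF inj subset_UNIV])
    show "bounded (?f ` {x. l1_norm x < 1})"
      by (rule bounded_subset[OF compact_imp_bounded[OF cB]]) (use B in blast)
    show "?f ` {x. l1_norm x < 1} \<inter> ?f ` {x. l1_norm x = 1} = {}"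
      unfolding image_Int[OF inj, symmetric] by auto
    show "closed ?B" using cB compact_imp_closed by blast
    show "connected (- ?B)"
      by (rule connected_complement_homeomorphic_convex_compact
            [OF homeomorphic_sym[THEN iffD1, OF hom] convex_l1_ball compact_l1_ball]) simp
    show "\<not> bounded (- ?B)"
      using cobounded_imp_unbounded[of "- ?B"] compact_imp_bounded[OF cB] by simp
  qed
qed

section \<open>Octahedral surfaces\<close>

definition octahedron_faces :: "nat set set" where
  "octahedron_faces = {{0,1,2}, {0,1,5}, {0,4,2}, {0,4,5}, {3,1,2}, {3,1,5}, {3,4,2}, {3,4,5}}"

lemma octahedron_faces_iff:
  "A \<in> octahedron_faces \<longleftrightarrow> (\<exists>i\<in>{0, 3}. \<exists>j\<in>{1, 4}. \<exists>k\<in>{2, 5}. A = {i, j, k})"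
  by (simp add: octahedron_faces_def)

text \<open>The weights belong to the indices and not to the points, so \<open>p\<close> need not be
  injective and the weights can be matched with orthant coordinates.\<close>

lemma convex_hull_image_finite:
  assumes "finite A"
  shows "convex hull (p ` A) = {\<Sum>v\<in>A. u v *\<^sub>R p v | u. (\<forall>v\<in>A. 0 \<le> u v) \<and> sum u A = (1::real)}" (is "_ = ?R")
proof (rule hull_unique)
  show "p ` A \<subseteq> ?R"
  proof clarify
    fix a assume a: "a \<in> A"
    have "p a = (\<Sum>v\<in>A. (if v = a then 1 else 0) *\<^sub>R p v)"
      using assms a by (simp add: if_distrib[of "\<lambda>c. c *\<^sub>R _"] sum.delta cong: if_cong)
    then show "\<exists>u. p a = (\<Sum>v\<in>A. u v *\<^sub>R p v) \<and> (\<forall>v\<in>A. 0 \<le> u v) \<and> sum u A = (1::real)"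
      using assms a by (intro exI[of _ "\<lambda>v. if v = a then 1 else 0"]) simp
  qed
  show "convex ?R"
  proof (rule convexI; clarify)
    fix s t :: real and u v
    assume h: "0 \<le> s" "0 \<le> t" "s + t = 1" "\<forall>x\<in>A. 0 \<le> u x" "sum u A = (1::real)"
      "\<forall>x\<in>A. 0 \<le> v x" "sum v A = (1::real)"
    show "\<exists>w. s *\<^sub>R (\<Sum>x\<in>A. u x *\<^sub>R p x) + t *\<^sub>R (\<Sum>x\<in>A. v x *\<^sub>R p x) = (\<Sum>x\<in>A. w x *\<^sub>R p x)
        \<and> (\<forall>x\<in>A. 0 \<le> w x) \<and> sum w A = (1::real)"
      using h by (intro exI[of _ "\<lambda>x. s * u x + t * v x"])
        (simp add: scaleR_right.sum sum.distrib scaleR_left_distrib flip: sum_distrib_left)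
  qed
  fix C assume C: "p ` A \<subseteq> C" "convex C"
  show "?R \<subseteq> C"
  proof clarify
    fix u assume "\<forall>v\<in>A. 0 \<le> u v" "sum u A = (1::real)"
    then show "(\<Sum>v\<in>A. u v *\<^sub>R p v) \<in> C"
      using C by (intro convex_sum assms) auto
  qed
qed

text \<open>Barycentric weights on a set without opposite vertices are exactly the orthant
  coordinates of a point of the l1 sphere. This covers faces and their intersections alike.\<close>

lemma convex_hull_eq_pl_map_image:
  assumes A: "A \<subseteq> {..<6}" and opp: "\<And>v. v \<in> A \<Longrightarrow> v + 3 \<notin> A"
  shows "convex hull (p ` A) = pl_map p ` {x. l1_norm x = 1 \<and> (\<forall>v. v \<notin> A \<longrightarrow> orthant_coord x v = 0)}"
    (is "_ = pl_map p ` ?K")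
proof -
  have fin: "finite A" using A finite_subset by blast
  have restrict: "(\<Sum>v<6. f v) = sum f A" if "\<And>v. v \<notin> A \<Longrightarrow> f v = 0" for f :: "nat \<Rightarrow> 'b::comm_monoid_add"
    using that A by (intro sum.mono_neutral_right) auto
  show ?thesis
    unfolding convex_hull_image_finite[OF fin]
  proof (intro equalityI subsetI)
    fix y assume "y \<in> {\<Sum>v\<in>A. u v *\<^sub>R p v | u. (\<forall>v\<in>A. 0 \<le> u v) \<and> sum u A = (1::real)}"
    then obtain u where y: "y = (\<Sum>v\<in>A. u v *\<^sub>R p v)" and u: "\<forall>v\<in>A. 0 \<le> u v" "sum u A = (1::real)"
      by blast
    define w where "w v = (if v \<in> A then u v else 0)" for v
    have w0: "w v \<ge> 0" for v using u by (simp add: w_def)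
    have wopp: "w v = 0 \<or> w (v + 3) = 0" for v using opp[of v] by (auto simp: w_def)
    \<comment> \<open>At most one weight of each opposite pair is nonzero, so the differences
      determine both.\<close>
    define x :: "real^3" where "x = vector [w 0 - w 3, w 1 - w 4, w 2 - w 5]"
    have coord: "orthant_coord x v = w v" for v
    proof (cases "v < 6")
      case True
      then have "v \<in> {0,1,2,3,4,5}" by auto
      then show ?thesis
        using wopp[of 0] wopp[of 1] wopp[of 2] w0 by (auto simp: orthant_coord_def x_def)
    next
      case False
      then show ?thesis using A by (auto simp: orthant_coord_def w_def)
    qed
    have "l1_norm x = sum w A"
      unfolding l1_norm_eq_sum coord by (rule restrict) (simp add: w_def)
    then have "x \<in> ?K" using u by (auto simp: coord) (simp_all add: w_def)
    moreover have "pl_map p x = (\<Sum>v\<in>A. w v *\<^sub>R p v)"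
      unfolding pl_map_def coord by (rule restrict) (simp add: w_def)
    then have "pl_map p x = y" by (simp add: y w_def)
    ultimately show "y \<in> pl_map p ` ?K" by blast
  next
    fix y assume "y \<in> pl_map p ` ?K"
    then obtain x where x: "y = pl_map p x" "l1_norm x = 1" "\<forall>v. v \<notin> A \<longrightarrow> orthant_coord x v = 0"
      by blast
    then have "y = (\<Sum>v\<in>A. orthant_coord x v *\<^sub>R p v)" "(\<Sum>v\<in>A. orthant_coord x v) = 1"
      unfolding l1_norm_eq_sum pl_map_def by (simp_all add: restrict)
    then show "y \<in> {\<Sum>v\<in>A. u v *\<^sub>R p v | u. (\<forall>v\<in>A. 0 \<le> u v) \<and> sum u A = (1::real)}"
      using orthant_coord_nonneg by blast
  qed
qed

lemma octahedron_face_no_opposite: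
  assumes "A \<in> octahedron_faces"
  shows "A \<subseteq> {..<6}" and "v \<in> A \<Longrightarrow> v + 3 \<notin> A"
proof -
  obtain i j k where ijk: "A = {i, j, k}" "i \<in> {0, 3}" "j \<in> {1, 4}" "k \<in> {2, 5}"
    using assms unfolding octahedron_faces_iff by blast
  then show "A \<subseteq> {..<6}" by auto
  assume "v \<in> A"
  with ijk have "v = i \<or> v = j \<or> v = k" by simp
  moreover have "w + 3 \<noteq> w'" if "w = i \<or> w = j \<or> w = k" "w' = i \<or> w' = j \<or> w' = k" for w w'
    using that ijk(2-4) by (elim insertE emptyE disjE; simp)
  ultimately show "v + 3 \<notin> A" unfolding ijk(1) by (metis empty_iff insert_iff)
qed

text \<open>On the l1 sphere a face is cut out by the vanishing of the orthant coordinates outside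
  its vertex set, so intersecting faces means intersecting vertex sets. Injectivity carries this
  over to the image.\<close>

lemma no_self_intersections_octahedron:
  assumes "positively_oriented p"
  shows "no_self_intersections octahedron_faces p"
  unfolding no_self_intersections_def
proof (intro ballI)
  fix A B assume AB: "A \<in> octahedron_faces" "B \<in> octahedron_faces"
  have hull: "convex hull (p ` A') = pl_map p ` {x. l1_norm x = 1 \<and> (\<forall>v. v \<notin> A' \<longrightarrow> orthant_coord x v = 0)}"
    if "A' \<subseteq> A \<or> A' \<subseteq> B" for A'
    using that AB octahedron_face_no_opposite by (intro convex_hull_eq_pl_map_image) blast+
  have "convex hull (p ` A) \<inter> convex hull (p ` B) = pl_map p ` ({x. l1_norm x = 1 \<and> (\<forall>v. v \<notin> A \<longrightarrow> orthant_coord x v = 0)}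
      \<inter> {x. l1_norm x = 1 \<and> (\<forall>v. v \<notin> B \<longrightarrow> orthant_coord x v = 0)})"
    by (simp add: hull image_Int[OF inj_pl_map[OF assms]])
  also have "\<dots> = convex hull (p ` (A \<inter> B))"
    unfolding hull[of "A \<inter> B", OF disjI1, OF Int_lower1] by (rule arg_cong[where f = "image _"]) blast
  finally show "convex hull (p ` A) \<inter> convex hull (p ` B) = convex hull (p ` (A \<inter> B))" .
qed

lemma surface_points_octahedron:
  "surface_points octahedron_faces p = pl_map p ` {x. l1_norm x = 1}"
proof -
  let ?K = "\<lambda>A. {x. l1_norm x = 1 \<and> (\<forall>v. v \<notin> A \<longrightarrow> orthant_coord x v = 0)}"
  have hull: "convex hull (p ` A) = pl_map p ` ?K A" if "A \<in> octahedron_faces" for A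
    using octahedron_face_no_opposite[OF that] by (intro convex_hull_eq_pl_map_image)
  have "\<exists>A\<in>octahedron_faces. x \<in> ?K A" if "l1_norm x = 1" for x
  proof
    let ?A = "{if x$1 \<ge> 0 then 0 else 3, if x$2 \<ge> 0 then 1 else 4, if x$3 \<ge> 0 then 2 else 5 :: nat}"
    show "?A \<in> octahedron_faces"
      by (simp add: octahedron_faces_iff)
    show "x \<in> ?K ?A"
      using that by (auto simp: orthant_coord_def split: if_splits)
  qed
  then have "{x. l1_norm x = 1} = (\<Union>A\<in>octahedron_faces. ?K A)" by blast
  moreover have "surface_points octahedron_faces p = (\<Union>A\<in>octahedron_faces. pl_map p ` ?K A)"
    unfolding surface_points_def by (intro SUP_cong refl hull)
  ultimately show ?thesis by (simp only: image_UN)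
qed

lemma homeomorphic_to_sphere_octahedron:
  assumes "positively_oriented p"
  shows "homeomorphic_to_sphere octahedron_faces p"
proof -
  have "{x. l1_norm x = 1} homeomorphic surface_points octahedron_faces p"
    by (rule homeomorphic_compact[OF compact_l1_sphere continuous_on_pl_map surface_points_octahedron[symmetric]])
      (rule inj_on_subset[OF inj_pl_map[OF assms] subset_UNIV])
  then show ?thesis
    unfolding homeomorphic_to_sphere_def
    by (rule homeomorphic_trans[OF homeomorphic_sym[THEN iffD1] l1_sphere_homeomorphic_sphere])
qed

lemma bounded_volume_octahedron:
  assumes "positively_oriented p"
  shows "bounded_volume octahedron_faces p = hyp_volume (pl_map p ` {x. l1_norm x < 1})"
  by (simp only: bounded_volume_def surface_points_octahedron inside_pl_map_l1_sphere[OF assms])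

section \<open>Hyperbolic volume of tetrahedra\<close>

lemma continuous_imp_absolutely_integrable_on_compact:
  fixes f :: "'a::euclidean_space \<Rightarrow> 'b::euclidean_space"
  assumes "compact K" "continuous_on K f"
  shows "f absolutely_integrable_on K"
proof -
  have "(\<lambda>x. indicator K x *\<^sub>R f x) \<in> borel_measurable borel"
    using assms by (intro borel_measurable_continuous_on_indicator) (auto simp: borel_compact)
  then show ?thesis
    using borel_integrable_compact[OF assms] unfolding set_integrable_def
    by (subst integrable_completion) auto
qed

text \<open>Dominated convergence for the difference quotients: the mean value inequality bounds
  them by the maximum \<open>C\<close> of the derivative over a compact set. The bound needs a
  parameter within \<delta>, hence the passage to a tail of the sequence.\<close>

lemma has_real_derivative_integral_compact:
  fixes \<phi> :: "real \<Rightarrow> 'a::euclidean_space \<Rightarrow> real"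
  assumes K: "compact K" and "0 < \<delta>"
    and cont: "\<And>t. \<bar>t\<bar> \<le> \<delta> \<Longrightarrow> continuous_on K (\<phi> t)"
    and deriv: "\<And>t x. \<bar>t\<bar> \<le> \<delta> \<Longrightarrow> x \<in> K \<Longrightarrow> ((\<lambda>t. \<phi> t x) has_real_derivative \<phi>' t x) (at t)"
    and cont': "continuous_on ({-\<delta>..\<delta>} \<times> K) (\<lambda>(t, x). \<phi>' t x)"
  shows "((\<lambda>t. integral K (\<phi> t)) has_real_derivative integral K (\<phi>' 0)) (at 0)"
proof -
  have "compact ((\<lambda>(t, x). \<phi>' t x) ` ({-\<delta>..\<delta>} \<times> K))"
    by (intro compact_continuous_image cont' compact_Times K compact_Icc)
  then obtain C where C: "\<And>t x. \<bar>t\<bar> \<le> \<delta> \<Longrightarrow> x \<in> K \<Longrightarrow> \<bar>\<phi>' t x\<bar> \<le> C"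
    by (fastforce dest!: compact_imp_bounded simp: bounded_iff abs_le_iff)
  have int: "\<phi> t integrable_on K" if "\<bar>t\<bar> \<le> \<delta>" for t
    using continuous_imp_absolutely_integrable_on_compact[OF K cont[OF that]]
    by (rule set_lebesgue_integral_eq_integral(1))
  have quot: "\<bar>(\<phi> t x - \<phi> 0 x) / t\<bar> \<le> C" if "\<bar>t\<bar> \<le> \<delta>" "t \<noteq> 0" "x \<in> K" for t x
  proof -
    have "norm (\<phi> t x - \<phi> 0 x) \<le> C * norm (t - 0)"
      by (rule field_differentiable_bound[where S = "{-\<delta>..\<delta>}" and f' = "\<lambda>t. \<phi>' t x"])
        (use that C deriv \<open>0 < \<delta>\<close> in \<open>auto simp: abs_le_iff intro: has_field_derivative_at_within\<close>)
    then show ?thesis using that by (simp add: divide_le_eq)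
  qed
  have "(\<lambda>h. (integral K (\<phi> h) - integral K (\<phi> 0)) / h) \<midarrow>0\<rightarrow> integral K (\<phi>' 0)"
    unfolding tendsto_at_iff_sequentially
  proof (intro allI impI)
    fix X :: "nat \<Rightarrow> real" assume X0: "\<forall>i. X i \<in> UNIV - {0}" and X: "X \<longlonglongrightarrow> 0"
    obtain N where "\<And>n. n \<ge> N \<Longrightarrow> \<bar>X n\<bar> < \<delta>"
      using LIMSEQ_D[OF X \<open>0 < \<delta>\<close>] by auto
    then have N: "\<bar>X (n + N)\<bar> \<le> \<delta>" "X (n + N) \<noteq> 0" for n
      using X0 by (auto intro: less_imp_le)
    let ?f = "\<lambda>n x. (\<phi> (X (n + N)) x - \<phi> 0 x) / X (n + N)"
    have "(\<lambda>n. integral K (?f n)) \<longlonglongrightarrow> integral K (\<phi>' 0)"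
    proof (rule dominated_convergence(2)[where h = "\<lambda>_. C"])
      show "?f n integrable_on K" for n
        using int[OF N(1)] int[of 0] \<open>0 < \<delta>\<close> by (intro integrable_on_divide integrable_diff) auto
      show "(\<lambda>_. C) integrable_on K"
        by (rule set_lebesgue_integral_eq_integral(1)[OF continuous_imp_absolutely_integrable_on_compact])
          (auto intro: K)
      show "norm (?f n x) \<le> C" if "x \<in> K" for n x
        using quot[OF N that] by simp
      show "(\<lambda>n. ?f n x) \<longlonglongrightarrow> \<phi>' 0 x" if "x \<in> K" for x
      proof -
        have "(\<lambda>h. (\<phi> (0 + h) x - \<phi> 0 x) / h) \<midarrow>0\<rightarrow> \<phi>' 0 x"
          using deriv[of 0 x] that \<open>0 < \<delta>\<close> by (simp add: DERIV_def)
        then have "((\<lambda>h. (\<phi> h x - \<phi> 0 x) / h) \<circ> X) \<longlonglongrightarrow> \<phi>' 0 x"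
          unfolding tendsto_at_iff_sequentially using X0 X by simp
        then have "(\<lambda>n. (\<phi> (X n) x - \<phi> 0 x) / X n) \<longlonglongrightarrow> \<phi>' 0 x"
          by (simp add: o_def)
        then show ?thesis by (rule LIMSEQ_ignore_initial_segment)
      qed
    qed
    moreover have "integral K (?f n) = (integral K (\<phi> (X (n + N))) - integral K (\<phi> 0)) / X (n + N)" for n
      using int[OF N(1)] int[of 0] \<open>0 < \<delta>\<close> by (simp add: integral_diff)
    ultimately have "(\<lambda>n. (integral K (\<phi> (X (n + N))) - integral K (\<phi> 0)) / X (n + N)) \<longlonglongrightarrow> integral K (\<phi>' 0)"
      by (simp only:)
    then show "((\<lambda>h. (integral K (\<phi> h) - integral K (\<phi> 0)) / h) \<circ> X) \<longlonglongrightarrow> integral K (\<phi>' 0)"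
      unfolding o_def by (rule LIMSEQ_offset)
  qed
  then show ?thesis by (simp add: DERIV_def)
qed

definition std_simplex :: "(real^3) set" where
  "std_simplex = {s. 0 \<le> s$1 \<and> 0 \<le> s$2 \<and> 0 \<le> s$3 \<and> s$1 + s$2 + s$3 \<le> 1}"

definition lin3 :: "real^3 \<Rightarrow> real^3 \<Rightarrow> real^3 \<Rightarrow> real^3 \<Rightarrow> real^3" where
  "lin3 u v w s = s$1 *\<^sub>R u + s$2 *\<^sub>R v + s$3 *\<^sub>R w"

text \<open>The hyperbolic volume of the tetrahedron with the vertices \<open>0\<close>, \<open>u\<close>, \<open>v\<close>, \<open>w\<close>.\<close>

definition tetra_volume :: "real^3 \<Rightarrow> real^3 \<Rightarrow> real^3 \<Rightarrow> real" where
  "tetra_volume u v w = integral std_simplex (\<lambda>s. \<bar>triple u v w\<bar> / (1 - (norm (lin3 u v w s))\<^sup>2)\<^sup>2)"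

lemma linear_lin3: "linear (lin3 u v w)"
  by (rule linearI) (simp_all add: lin3_def algebra_simps)

lemma continuous_on_lin3: "continuous_on S (lin3 u v w)"
  by (rule linear_continuous_on) (simp add: linear_conv_bounded_linear[symmetric] linear_lin3)

lemma det_matrix_lin3: "det (matrix (lin3 u v w)) = triple u v w"
  by (simp add: matrix_def det_3 lin3_def triple_def axis_def algebra_simps)

lemma compact_std_simplex: "compact std_simplex"
proof -
  have "closed std_simplex"
    unfolding std_simplex_def
    by (intro closed_Collect_conj closed_Collect_le continuous_intros)
  moreover have "bounded std_simplex"
    by (rule bounded_subset[OF bounded_l1_ball[of 1]]) (auto simp: std_simplex_def l1_norm_def)
  ultimately show ?thesis by (simp add: compact_eq_bounded_closed)
qed

lemma norm_lin3_less_1: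
  assumes "s \<in> std_simplex" "norm u < 1" "norm v < 1" "norm w < 1"
  shows "norm (lin3 u v w s) < 1"
proof -
  define m where "m = max (norm u) (max (norm v) (norm w))"
  have m: "0 \<le> m" "m < 1" "norm u \<le> m" "norm v \<le> m" "norm w \<le> m"
    using assms by (auto simp: m_def le_max_iff_disj)
  have "norm (lin3 u v w s) \<le> s$1 * norm u + s$2 * norm v + s$3 * norm w"
    using assms(1) unfolding lin3_def std_simplex_def
    by (intro norm_triangle_le add_mono) auto
  also have "\<dots> \<le> s$1 * m + s$2 * m + s$3 * m"
    using assms(1) m unfolding std_simplex_def by (intro add_mono mult_left_mono) auto
  also have "\<dots> = (s$1 + s$2 + s$3) * m" by (simp add: algebra_simps)
  also have "\<dots> \<le> 1 * m"
    using assms(1) m unfolding std_simplex_def by (intro mult_right_mono) auto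
  finally show ?thesis using m by simp
qed

lemma has_integral_density_tetrahedron:
  assumes tri: "triple u v w \<noteq> 0" and norm: "norm u < 1" "norm v < 1" "norm w < 1"
  shows "((\<lambda>x. 1 / (1 - (norm x)\<^sup>2)\<^sup>2) has_integral tetra_volume u v w) (lin3 u v w ` std_simplex)"
proof -
  let ?g = "lin3 u v w" and ?h = "\<lambda>x :: real^3. 1 / (1 - (norm x)\<^sup>2)\<^sup>2"
  have inj: "inj_on ?g std_simplex"
  proof (rule inj_onI)
    fix s t assume "?g s = ?g t"
    then have "(s$1 - t$1) *\<^sub>R u + (s$2 - t$2) *\<^sub>R v + (s$3 - t$3) *\<^sub>R w = 0"
      by (simp add: lin3_def algebra_simps)
    from triple_nonzero_imp_independent[OF tri this] show "s = t"
      by (simp add: vec_eq_iff forall_3)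
  qed
  have "(norm (?g s))\<^sup>2 \<noteq> 1" if "s \<in> std_simplex" for s
    using norm_lin3_less_1[OF that norm] norm_ge_zero[of "?g s"] power2_eq_1_iff[of "norm (?g s)"] by linarith
  then have "continuous_on std_simplex (\<lambda>s. \<bar>triple u v w\<bar> * ?h (?g s))"
    by (intro continuous_intros continuous_on_lin3) auto
  then have ai: "(\<lambda>s. \<bar>triple u v w\<bar> * ?h (?g s)) absolutely_integrable_on std_simplex"
    by (intro continuous_imp_absolutely_integrable_on_compact compact_std_simplex)
  have der: "(?g has_derivative ?g) (at s within std_simplex)" for s
    by (rule linear_imp_has_derivative[OF linear_lin3])
  \<comment> \<open>The change of variables theorem applied below concerns vector-valued functions,
    so the density is read as a function into \<open>real^1\<close>.\<close>
  have "(\<lambda>s. \<bar>det (matrix ?g)\<bar> *\<^sub>R (vec (?h (?g s)) :: real^1))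
      = (\<lambda>s. vec (\<bar>triple u v w\<bar> * ?h (?g s)))"
    by (simp add: det_matrix_lin3 vec_eq_iff fun_eq_iff)
  then have "(\<lambda>s. \<bar>det (matrix ?g)\<bar> *\<^sub>R (vec (?h (?g s)) :: real^1)) absolutely_integrable_on std_simplex \<and>
      integral std_simplex (\<lambda>s. \<bar>det (matrix ?g)\<bar> *\<^sub>R (vec (?h (?g s)) :: real^1)) = vec (tetra_volume u v w)"
    using ai by (simp only: absolutely_integrable_on_1_iff integral_on_1_eq tetra_volume_def
        vec_component times_divide_eq_right mult_1_right simp_thms)
  then have "(\<lambda>x. vec (?h x) :: real^1) absolutely_integrable_on (?g ` std_simplex) \<and>
      integral (?g ` std_simplex) (\<lambda>x. vec (?h x) :: real^1) = vec (tetra_volume u v w)"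
    by (rule iffD1[OF has_absolute_integral_change_of_variables
          [OF fmeasurableD[OF lmeasurable_compact[OF compact_std_simplex]] der inj]])
  then have "?h integrable_on (?g ` std_simplex)" "integral (?g ` std_simplex) ?h = tetra_volume u v w"
    by (auto simp: absolutely_integrable_on_1_iff integral_on_1_eq vec_eq_iff
        dest: set_lebesgue_integral_eq_integral(1))
  then show ?thesis by (simp add: has_integral_integrable_integral)
qed

section \<open>Decomposition of the enclosed volume\<close>

lemma lin3_image_std_simplex:
  assumes ijk: "i \<in> {0, 3}" "j \<in> {1, 4}" "k \<in> {2, 5}"
  shows "lin3 (p i) (p j) (p k) ` std_simplex
    = pl_map p ` {x. l1_norm x \<le> 1 \<and> (\<forall>v. v \<notin> {i, j, k} \<longrightarrow> orthant_coord x v = 0)}"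
    (is "_ = pl_map p ` ?R")
proof (intro equalityI subsetI)
  fix y assume "y \<in> lin3 (p i) (p j) (p k) ` std_simplex"
  then obtain s where s: "s \<in> std_simplex" "y = lin3 (p i) (p j) (p k) s" by blast
  define x :: "real^3" where "x = vector [if i = 0 then s$1 else - s$1,
    if j = 1 then s$2 else - s$2, if k = 2 then s$3 else - s$3]"
  have "l1_norm x \<le> 1" using s(1) by (simp add: x_def l1_norm_def std_simplex_def)
  moreover have "orthant_coord x v = 0" if "v \<notin> {i, j, k}" for v
    using that ijk s(1) by (auto simp: x_def orthant_coord_def std_simplex_def)
  moreover have "pl_map p x = y"
    using ijk s unfolding pl_map_alt lin3_def std_simplex_def x_def by auto
  ultimately show "y \<in> pl_map p ` ?R" by blast
next
  fix y assume "y \<in> pl_map p ` ?R"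
  then obtain x where x: "y = pl_map p x" "l1_norm x \<le> 1" "\<And>v. v \<notin> {i, j, k} \<Longrightarrow> orthant_coord x v = 0"
    by blast
  have distinct: "i \<noteq> j" "i \<noteq> k" "j \<noteq> k" using ijk by auto
  have restrict: "(\<Sum>v<6. f v) = f i + f j + f k" if "\<And>v. v \<notin> {i, j, k} \<Longrightarrow> f v = 0"
    for f :: "nat \<Rightarrow> 'b::comm_monoid_add"
  proof -
    have "(\<Sum>v<6. f v) = sum f {i, j, k}"
      using that ijk by (intro sum.mono_neutral_right) auto
    then show ?thesis using distinct by (simp add: add.assoc)
  qed
  define s :: "real^3" where "s = vector [orthant_coord x i, orthant_coord x j, orthant_coord x k]"
  have "y = lin3 (p i) (p j) (p k) s"
    unfolding x(1) pl_map_def lin3_def s_def by (subst restrict) (simp_all add: x(3))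
  moreover have "l1_norm x = orthant_coord x i + orthant_coord x j + orthant_coord x k"
    unfolding l1_norm_eq_sum by (rule restrict) (rule x(3))
  then have "s \<in> std_simplex"
    using x(2) by (simp add: std_simplex_def s_def orthant_coord_nonneg)
  ultimately show "y \<in> lin3 (p i) (p j) (p k) ` std_simplex" by blast
qed

text \<open>Taking positive parts is 1-Lipschitz, so \<open>pl_map p\<close> is Lipschitz and
  preserves null sets.\<close>

lemma negligible_pl_map_image:
  assumes "negligible N"
  shows "negligible (pl_map p ` N)"
proof (rule negligible_locally_Lipschitz_image[OF order_refl assms])
  fix x assume "x \<in> N"
  have "norm (pl_map p y - pl_map p x) \<le> (\<Sum>v<6. norm (p v)) * norm (y - x)" for y
  proof -
    have pp: "\<bar>max 0 a - max 0 b\<bar> \<le> \<bar>a - b\<bar>" for a b :: real by (auto simp: max_def)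
    have comp: "\<bar>max 0 (y$m) - max 0 (x$m)\<bar> \<le> norm (y - x)"
      "\<bar>max 0 (- y$m) - max 0 (- x$m)\<bar> \<le> norm (y - x)" for m
      using component_le_norm_cart[of "y - x" m] pp[of "y$m" "x$m"] pp[of "- y$m" "- x$m"]
      unfolding vector_minus_component by linarith+
    have coord: "\<bar>orthant_coord y v - orthant_coord x v\<bar> \<le> norm (y - x)" for v
      unfolding orthant_coord_def using comp by simp
    have "norm (pl_map p y - pl_map p x) = norm (\<Sum>v<6. (orthant_coord y v - orthant_coord x v) *\<^sub>R p v)"
      by (simp add: pl_map_def sum_subtractf scaleR_left_diff_distrib)
    also have "\<dots> \<le> (\<Sum>v<6. norm (y - x) * norm (p v))"
      by (intro sum_norm_le) (simp add: mult_right_mono[OF coord])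
    finally show ?thesis by (simp add: sum_distrib_left mult.commute)
  qed
  then show "\<exists>T B. open T \<and> x \<in> T \<and> (\<forall>y\<in>N \<inter> T. norm (pl_map p y - pl_map p x) \<le> B * norm (y - x))"
    by (intro exI[of _ UNIV] exI[of _ "\<Sum>v<6. norm (p v)"]) auto
qed

text \<open>The sphere lies in the union of eight planes, one for each choice of signs.\<close>

lemma negligible_l1_sphere: "negligible {x. l1_norm x = 1}"
proof -
  let ?S = "\<lambda>a b c. {x :: real^3. vector [a, b, c] \<bullet> x = (1::real)}"
  have "negligible (\<Union>a\<in>{-1, 1}. \<Union>b\<in>{-1, 1}. \<Union>c\<in>{-1, 1}. ?S a b c)"
    by (auto intro!: negligible_Un negligible_hyperplane)
  moreover have "{x. l1_norm x = 1} \<subseteq> (\<Union>a\<in>{-1, 1}. \<Union>b\<in>{-1, 1}. \<Union>c\<in>{-1, 1}. ?S a b c)"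
    by (auto simp: l1_norm_def inner_vec_def sum_3 abs_if split: if_splits)
  ultimately show ?thesis by (rule negligible_subset)
qed

lemma negligible_coordinate_planes: "negligible {x :: real^3. x$1 = 0 \<or> x$2 = 0 \<or> x$3 = 0}"
proof -
  have "negligible {x :: real^3. axis m 1 \<bullet> x = 0}" for m :: 3
    by (rule negligible_hyperplane) (simp add: axis_eq_0_iff)
  then have "negligible {x :: real^3. x$m = 0}" for m
    by (simp add: inner_axis')
  then show ?thesis
    by (simp add: Collect_disj_eq)
qed

definition orthant_sign :: "nat \<Rightarrow> nat \<Rightarrow> nat \<Rightarrow> real" where
  "orthant_sign i j k = (if i = 0 then 1 else -1) * (if j = 1 then 1 else -1) * (if k = 2 then 1 else -1)"

lemma positively_oriented_triple:
  assumes "positively_oriented p" "i \<in> {0, 3}" "j \<in> {1, 4}" "k \<in> {2, 5}"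
  shows "0 < orthant_sign i j k * triple (p i) (p j) (p k)"
proof -
  have "triple (- u) v w = - triple u v w" "triple u (- v) w = - triple u v w"
    "triple u v (- w) = - triple u v w" for u v w
    by (simp_all add: triple_def algebra_simps)
  then show ?thesis
    using assms unfolding positively_oriented_def orthant_sign_def by auto
qed

definition orthants :: "(nat \<times> nat \<times> nat) set" where
  "orthants = {0, 3} \<times> {1, 4} \<times> {2, 5}"

text \<open>Two of the tetrahedra overlap at most in the image of the coordinate planes, and the
  closed octahedron exceeds the open one by the image of the l1 sphere. Both images are null
  sets.\<close>

lemma hyp_volume_pl_map_l1_ball:
  assumes pos: "positively_oriented p" and norm: "\<And>v. v < 6 \<Longrightarrow> norm (p v) < 1"
  shows "hyp_volume (pl_map p ` {x. l1_norm x < 1})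
    = (\<Sum>(i, j, k)\<in>orthants. tetra_volume (p i) (p j) (p k))"
proof -
  let ?h = "\<lambda>x :: real^3. 1 / (1 - (norm x)\<^sup>2)\<^sup>2"
  let ?T = "\<lambda>(i, j, k). lin3 (p i) (p j) (p k) ` std_simplex"
  let ?R = "\<lambda>(i, j, k). {x. l1_norm x \<le> 1 \<and> (\<forall>v. v \<notin> {i, j, k} \<longrightarrow> orthant_coord x v = 0)}"
  let ?W = "pl_map p ` {x. l1_norm x < 1}"
  let ?V = "\<Sum>a\<in>orthants. case a of (i, j, k) \<Rightarrow> tetra_volume (p i) (p j) (p k)"
  note inj = inj_pl_map[OF pos]
  have T: "?T a = pl_map p ` ?R a" if a: "a \<in> orthants" for a
  proof -
    obtain i j k where "a = (i, j, k)" "i \<in> {0, 3}" "j \<in> {1, 4}" "k \<in> {2, 5}"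
      using a unfolding orthants_def by blast
    then show ?thesis by (simp only: prod.case lin3_image_std_simplex)
  qed
  have cover: "(\<Union>a\<in>orthants. ?R a) = {x. l1_norm x \<le> 1}"
  proof (intro equalityI subsetI)
    fix x assume x: "x \<in> {x. l1_norm x \<le> 1}"
    let ?a = "(if x$1 \<ge> 0 then 0 else 3, if x$2 \<ge> 0 then 1 else 4, if x$3 \<ge> 0 then 2 else 5)"
    have "?a \<in> orthants" by (auto simp: orthants_def)
    moreover have "x \<in> ?R ?a" using x by (auto simp: orthant_coord_def)
    ultimately show "x \<in> (\<Union>a\<in>orthants. ?R a)" by blast
  qed auto
  have overlap: "?R a \<inter> ?R b \<subseteq> {x. x$1 = 0 \<or> x$2 = 0 \<or> x$3 = 0}"
    if ab: "a \<in> orthants" "b \<in> orthants" "a \<noteq> b" for a b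
  proof
    fix x assume x: "x \<in> ?R a \<inter> ?R b"
    obtain i j k where a: "a = (i, j, k)" "i \<in> {0, 3}" "j \<in> {1, 4}" "k \<in> {2, 5}"
      using ab unfolding orthants_def by blast
    obtain i' j' k' where b: "b = (i', j', k')" "i' \<in> {0, 3}" "j' \<in> {1, 4}" "k' \<in> {2, 5}"
      using ab unfolding orthants_def by blast
    have x0: "orthant_coord x v = 0" if "v \<notin> {i, j, k} \<or> v \<notin> {i', j', k'}" for v
      using x that unfolding a(1) b(1) by auto
    \<comment> \<open>Where the orthants choose different vertices of an opposite pair, both
      coordinates of that pair must vanish, so the point lies on a coordinate plane.\<close>
    have "i \<noteq> i' \<or> j \<noteq> j' \<or> k \<noteq> k'" using ab(3) unfolding a(1) b(1) by simp
    then consider "i \<noteq> i'" | "j \<noteq> j'" | "k \<noteq> k'" by blast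
    then show "x \<in> {x. x$1 = 0 \<or> x$2 = 0 \<or> x$3 = 0}"
    proof cases
      case 1
      have "orthant_coord x v = 0" if v: "v \<in> {0, 3}" for v
      proof -
        have "v \<noteq> j" using v a(3) by auto
        moreover have "v \<noteq> j'" using v b(3) by auto
        moreover
        have "v \<noteq> k" using v a(4) by auto
        moreover have "v \<noteq> k'" using v b(4) by auto
        moreover have "v \<noteq> i \<or> v \<noteq> i'" using 1 by blast
        ultimately show ?thesis by (intro x0) blast
      qed
      from this[of 0] this[of 3] have "max 0 (x$1) = 0" "max 0 (- x$1) = 0"
        by (simp_all add: orthant_coord_def)
      then have "x$1 = 0" by linarith
      then show ?thesis by simp
    next
      case 2
      have "orthant_coord x v = 0" if v: "v \<in> {1, 4}" for v
      proof -
        have "v \<noteq> i" using v a(2) by auto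
        moreover have "v \<noteq> i'" using v b(2) by auto
        moreover
        have "v \<noteq> k" using v a(4) by auto
        moreover have "v \<noteq> k'" using v b(4) by auto
        moreover have "v \<noteq> j \<or> v \<noteq> j'" using 2 by blast
        ultimately show ?thesis by (intro x0) blast
      qed
      from this[of 1] this[of 4] have "max 0 (x$2) = 0" "max 0 (- x$2) = 0"
        by (simp_all add: orthant_coord_def)
      then have "x$2 = 0" by linarith
      then show ?thesis by simp
    next
      case 3
      have "orthant_coord x v = 0" if v: "v \<in> {2, 5}" for v
      proof -
        have "v \<noteq> i" using v a(2) by auto
        moreover have "v \<noteq> i'" using v b(2) by auto
        moreover
        have "v \<noteq> j" using v a(3) by auto
        moreover have "v \<noteq> j'" using v b(3) by auto
        moreover have "v \<noteq> k \<or> v \<noteq> k'" using 3 by blast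
        ultimately show ?thesis by (intro x0) blast
      qed
      from this[of 2] this[of 5] have "max 0 (x$3) = 0" "max 0 (- x$3) = 0"
        by (simp_all add: orthant_coord_def)
      then have "x$3 = 0" by linarith
      then show ?thesis by simp
    qed
  qed
  have "(?h has_integral ?V) (\<Union>a\<in>orthants. ?T a)"
  proof (rule has_integral_UN)
    show "finite orthants" by (simp add: orthants_def)
    fix a assume "a \<in> orthants"
    then obtain i j k where a: "a = (i, j, k)" "i \<in> {0, 3}" "j \<in> {1, 4}" "k \<in> {2, 5}"
      unfolding orthants_def by blast
    have "triple (p i) (p j) (p k) \<noteq> 0"
      using positively_oriented_triple[OF pos a(2-4)] by (metis less_irrefl mult_zero_right)
    moreover have "norm (p i) < 1" "norm (p j) < 1" "norm (p k) < 1"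
      using a by (auto intro!: norm)
    ultimately show "(?h has_integral (case a of (i, j, k) \<Rightarrow> tetra_volume (p i) (p j) (p k))) (?T a)"
      unfolding a(1) prod.case by (rule has_integral_density_tetrahedron)
  next
    show "pairwise (\<lambda>a b. negligible (?T a \<inter> ?T b)) orthants"
    proof (rule pairwiseI)
      fix a b assume ab: "a \<in> orthants" "b \<in> orthants" "a \<noteq> b"
      have "?T a \<inter> ?T b = pl_map p ` (?R a \<inter> ?R b)"
        by (simp only: T[OF ab(1)] T[OF ab(2)] image_Int[OF inj])
      then show "negligible (?T a \<inter> ?T b)"
        using negligible_pl_map_image[OF negligible_subset[OF negligible_coordinate_planes overlap[OF ab]]]
        by simp
    qed
  qed
  also have union: "(\<Union>a\<in>orthants. ?T a) = pl_map p ` {x. l1_norm x \<le> 1}"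
    unfolding cover[symmetric] image_UN by (intro SUP_cong refl T)
  finally have intB: "(?h has_integral ?V) (pl_map p ` {x. l1_norm x \<le> 1})" .
  have neg: "negligible {y \<in> pl_map p ` {x. l1_norm x \<le> 1} - ?W. ?h y \<noteq> 0}"
    by (rule negligible_subset[OF negligible_pl_map_image[OF negligible_l1_sphere]]) force
  have "negligible {y \<in> ?W - pl_map p ` {x. l1_norm x \<le> 1}. ?h y \<noteq> 0}"
    by (rule negligible_subset[OF negligible_empty]) (force intro: less_imp_le)
  then have int: "(?h has_integral ?V) ?W"
    by (rule iffD2[OF has_integral_spike_set_eq intB]) (rule neg)
  have W: "?W \<subseteq> klein_ball"
  proof -
    have "?W \<subseteq> (\<Union>a\<in>orthants. ?T a)" unfolding union by (auto intro: less_imp_le)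
    moreover have "?T a \<subseteq> klein_ball" if a_in: "a \<in> orthants" for a
    proof -
      obtain i j k where a: "a = (i, j, k)" "i \<in> {0, 3}" "j \<in> {1, 4}" "k \<in> {2, 5}"
        using a_in unfolding orthants_def by blast
      have "norm (p i) < 1" "norm (p j) < 1" "norm (p k) < 1"
        using a by (auto intro!: norm)
      then show ?thesis unfolding a(1) klein_ball_def by (auto intro: norm_lin3_less_1)
    qed
    ultimately show ?thesis by blast
  qed
  have "klein_ball \<in> sets borel" by (simp add: klein_ball_def)
  then have [measurable]: "(\<lambda>x. indicator klein_ball x / (1 - (norm x)\<^sup>2)\<^sup>2 :: real) \<in> borel_measurable borel"
    by (intro borel_measurable_divide borel_measurable_indicator borel_measurable_power
        borel_measurable_diff borel_measurable_const borel_measurable_norm measurable_ident) simp_all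
  have "open ?W"
    by (intro invariance_of_domain continuous_on_pl_map open_l1_ball inj_on_subset[OF inj subset_UNIV])
  then have "emeasure hyp_measure ?W
      = (\<integral>\<^sup>+ x. ennreal (indicator klein_ball x / (1 - (norm x)\<^sup>2)\<^sup>2) * indicator ?W x \<partial>lborel)"
    unfolding hyp_measure_def by (intro emeasure_density) auto
  also have "\<dots> = (\<integral>\<^sup>+ x. ennreal (indicator ?W x * ?h x) \<partial>lborel)"
    using W by (intro nn_integral_cong) (auto simp: indicator_def)
  also have "\<dots> = ennreal ?V"
    by (rule nn_integral_has_integral_lebesgue[OF _ int]) simp
  finally have "emeasure hyp_measure ?W = ennreal ?V" .
  moreover have "0 \<le> ?V" by (rule has_integral_nonneg[OF int]) simp
  ultimately show ?thesis unfolding hyp_volume_def measure_def by simp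
qed

section \<open>First variation of the volume\<close>

lemma continuous_on_triple [continuous_intros]:
  assumes "continuous_on S f" "continuous_on S g" "continuous_on S h"
  shows "continuous_on S (\<lambda>t. triple (f t) (g t) (h t))"
  unfolding triple_def by (intro continuous_intros assms)

lemma triple_along_line:
  "triple (u + t *\<^sub>R u') (v + t *\<^sub>R v') (w + t *\<^sub>R w')
    = triple u v w + t * (triple u' v w + triple u v' w + triple u v w')
      + t^2 * (triple u' v' w + triple u' v w' + triple u v' w') + t^3 * triple u' v' w'"
  by (simp add: triple_def algebra_simps power2_eq_square power3_eq_cube)

lemma lin3_along_line:
  "lin3 (u + t *\<^sub>R u') (v + t *\<^sub>R v') (w + t *\<^sub>R w') s = lin3 u v w s + t *\<^sub>R lin3 u' v' w' s"
  by (simp add: lin3_def algebra_simps)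

text \<open>A quadratic form in the nonnegative weights all of whose coefficients are nonpositive.
  Thus control of vertices and edges alone keeps every point of the tetrahedron from receding from
  the origin.\<close>

lemma inner_lin3_nonpos:
  assumes "s \<in> std_simplex"
    and "u \<bullet> u' \<le> 0" "v \<bullet> v' \<le> 0" "w \<bullet> w' \<le> 0"
    and "u \<bullet> v' + v \<bullet> u' \<le> 0" "u \<bullet> w' + w \<bullet> u' \<le> 0" "v \<bullet> w' + w \<bullet> v' \<le> 0"
  shows "lin3 u v w s \<bullet> lin3 u' v' w' s \<le> 0"
proof -
  have "lin3 u v w s \<bullet> lin3 u' v' w' s
    = (s$1)\<^sup>2 * (u \<bullet> u') + (s$2)\<^sup>2 * (v \<bullet> v') + (s$3)\<^sup>2 * (w \<bullet> w')
      + (s$1 * s$2) * (u \<bullet> v' + v \<bullet> u') + (s$1 * s$3) * (u \<bullet> w' + w \<bullet> u')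
      + (s$2 * s$3) * (v \<bullet> w' + w \<bullet> v')"
    by (simp add: lin3_def inner_simps algebra_simps power2_eq_square)
  moreover have "(s$1)\<^sup>2 * (u \<bullet> u') \<le> 0" "(s$2)\<^sup>2 * (v \<bullet> v') \<le> 0" "(s$3)\<^sup>2 * (w \<bullet> w') \<le> 0"
    "(s$1 * s$2) * (u \<bullet> v' + v \<bullet> u') \<le> 0" "(s$1 * s$3) * (u \<bullet> w' + w \<bullet> u') \<le> 0"
    "(s$2 * s$3) * (v \<bullet> w' + w \<bullet> v') \<le> 0"
    using assms by (auto simp: std_simplex_def intro!: mult_nonneg_nonpos[of "_ * _"] mult_nonneg_nonpos[of "_ ^ 2"])
  ultimately show ?thesis by linarith
qed

text \<open>In terms of the radial density \<open>1 / (1 - |x|\<^sup>2)\<^sup>2\<close>, a motion that shrinks the distances to the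
  origin and the Euclidean volume shrinks the hyperbolic volume, at least by the Euclidean
  decrease.\<close>

lemma tetra_volume_along_line_deriv:
  assumes norm: "norm u < 1" "norm v < 1" "norm w < 1"
    and \<sigma>: "\<sigma> \<in> {-1, 1}" "0 < \<sigma> * triple u v w"
    and \<tau>: "\<tau> = \<sigma> * (triple u' v w + triple u v' w + triple u v w')" "\<tau> \<le> 0"
    and inner: "u \<bullet> u' \<le> 0" "v \<bullet> v' \<le> 0" "w \<bullet> w' \<le> 0"
      "u \<bullet> v' + v \<bullet> u' \<le> 0" "u \<bullet> w' + w \<bullet> u' \<le> 0" "v \<bullet> w' + w \<bullet> v' \<le> 0"
  shows "\<exists>D. ((\<lambda>t. tetra_volume (u + t *\<^sub>R u') (v + t *\<^sub>R v') (w + t *\<^sub>R w')) has_real_derivative D) (at 0)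
    \<and> D \<le> \<tau> * measure lebesgue std_simplex"
proof -
  let ?U = "\<lambda>t. u + t *\<^sub>R u'" and ?V = "\<lambda>t. v + t *\<^sub>R v'" and ?W = "\<lambda>t. w + t *\<^sub>R w'"
  let ?T = "\<lambda>t. \<sigma> * triple (?U t) (?V t) (?W t)"
  let ?a = "lin3 u v w" and ?b = "lin3 u' v' w'"
  \<comment> \<open>On a small interval the orientation cannot change, so the absolute value in
    \<open>tetra_volume\<close> is multiplication by the constant sign \<sigma>.\<close>
  have "open {t. norm (?U t) < 1 \<and> norm (?V t) < 1 \<and> norm (?W t) < 1 \<and> 0 < ?T t}"
    by (intro open_Collect_conj open_Collect_less continuous_intros)
  moreover have "0 \<in> {t. norm (?U t) < 1 \<and> norm (?V t) < 1 \<and> norm (?W t) < 1 \<and> 0 < ?T t}"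
    using norm \<sigma> by simp
  ultimately obtain \<delta> where \<delta>: "0 < \<delta>" and
    "cball 0 \<delta> \<subseteq> {t. norm (?U t) < 1 \<and> norm (?V t) < 1 \<and> norm (?W t) < 1 \<and> 0 < ?T t}"
    using open_contains_cball_eq by blast
  then have near: "norm (?U t) < 1" "norm (?V t) < 1" "norm (?W t) < 1" "0 < ?T t" if "\<bar>t\<bar> \<le> \<delta>" for t
    using that by (auto simp: subset_iff)
  define c2 c3 where "c2 = \<sigma> * (triple u' v' w + triple u' v w' + triple u v' w')"
    and "c3 = \<sigma> * triple u' v' w'"
  have T: "?T t = \<sigma> * triple u v w + t * \<tau> + t^2 * c2 + t^3 * c3" for t
    unfolding triple_along_line \<tau> c2_def c3_def by (simp add: algebra_simps)
  define N where "N t s = (?a s + t *\<^sub>R ?b s) \<bullet> (?a s + t *\<^sub>R ?b s)" for t s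
  define N' where "N' t s = 2 * (?a s \<bullet> ?b s) + 2 * t * (?b s \<bullet> ?b s)" for t s
  have N: "N t s < 1" if "\<bar>t\<bar> \<le> \<delta>" "s \<in> std_simplex" for t s
  proof -
    have "norm (?a s + t *\<^sub>R ?b s) < 1"
      using norm_lin3_less_1[OF that(2) near(1-3)[OF that(1)]] unfolding lin3_along_line .
    then show ?thesis
      unfolding N_def dot_square_norm by (simp add: power_less_one_iff)
  qed
  have N_deriv: "((\<lambda>t. N t s) has_real_derivative N' t s) (at t)" for t s
  proof -
    have "N t s = ?a s \<bullet> ?a s + 2 * t * (?a s \<bullet> ?b s) + t^2 * (?b s \<bullet> ?b s)" for t
      by (simp add: N_def inner_simps inner_commute algebra_simps power2_eq_square)
    then show ?thesis
      unfolding N'_def by (auto intro!: derivative_eq_intros simp: algebra_simps)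
  qed
  define \<phi> where "\<phi> t s = ?T t / (1 - N t s)^2" for t s
  \<comment> \<open>The first summand is due to the Euclidean volume, the second to the change of
    the density along the motion.\<close>
  define \<phi>' where "\<phi>' t s = (\<tau> + 2 * t * c2 + 3 * t^2 * c3) / (1 - N t s)^2
      + ?T t * 2 * N' t s / (1 - N t s)^3" for t s
  have cont_pair: "continuous_on S (\<lambda>(t, s). N t s)" "continuous_on S (\<lambda>(t, s). N' t s)" for S
    unfolding N_def N'_def case_prod_beta lin3_def by (intro continuous_intros)+
  have deriv: "((\<lambda>t. integral std_simplex (\<phi> t)) has_real_derivative integral std_simplex (\<phi>' 0)) (at 0)"
  proof (rule has_real_derivative_integral_compact[OF compact_std_simplex \<delta>])
    fix t assume t: "\<bar>t\<bar> \<le> \<delta>"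
    show "continuous_on std_simplex (\<phi> t)"
      unfolding \<phi>_def N_def lin3_def
      by (intro continuous_intros) (use N[OF t] in \<open>force simp: N_def lin3_def\<close>)
    fix s assume s: "s \<in> std_simplex"
    have "?T = (\<lambda>t. \<sigma> * triple u v w + t * \<tau> + t^2 * c2 + t^3 * c3)"
      by (rule ext) (rule T)
    then have Td: "(?T has_real_derivative \<tau> + 2 * t * c2 + 3 * t^2 * c3) (at t)"
      by (auto intro!: derivative_eq_intros)
    have nz: "1 - N t s \<noteq> 0" using N[OF t s] by simp
    show "((\<lambda>t. \<phi> t s) has_real_derivative \<phi>' t s) (at t)"
      unfolding \<phi>_def \<phi>'_def
      by (rule derivative_eq_intros Td N_deriv refl | use nz in \<open>simp; fail\<close>)+
        (use nz in \<open>simp add: divide_simps power2_eq_square power3_eq_cube; simp add: algebra_simps\<close>)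
  next
    have nz: "1 - N (fst z) (snd z) \<noteq> 0" if "z \<in> {-\<delta>..\<delta>} \<times> std_simplex" for z
      using N[of "fst z" "snd z"] that by (auto simp: abs_le_iff)
    show "continuous_on ({-\<delta>..\<delta>} \<times> std_simplex) (\<lambda>(t, s). \<phi>' t s)"
      using cont_pair nz unfolding \<phi>'_def case_prod_beta
      by (intro continuous_intros) auto
  qed
  have eq: "tetra_volume (?U t) (?V t) (?W t) = integral std_simplex (\<phi> t)" if "\<bar>t\<bar> \<le> \<delta>" for t
  proof -
    have "\<bar>triple (?U t) (?V t) (?W t)\<bar> = ?T t"
      using near(4)[OF that] \<sigma>(1) by auto
    then show ?thesis
      unfolding tetra_volume_def lin3_along_line \<phi>_def N_def by (simp add: dot_square_norm)
  qed
  have "((\<lambda>t. tetra_volume (?U t) (?V t) (?W t)) has_real_derivative integral std_simplex (\<phi>' 0)) (at 0)"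
    by (rule has_field_derivative_transform_within[OF deriv \<delta>]) (auto simp: eq)
  moreover have "integral std_simplex (\<phi>' 0) \<le> integral std_simplex (\<lambda>_. \<tau>)"
  proof (rule integral_le)
    have "continuous_on std_simplex (\<phi>' 0)"
      using N[of 0] \<delta> unfolding \<phi>'_def N_def N'_def lin3_def
      by (intro continuous_intros) (force simp: lin3_def)+
    then show "\<phi>' 0 integrable_on std_simplex"
      by (rule set_lebesgue_integral_eq_integral(1)
          [OF continuous_imp_absolutely_integrable_on_compact[OF compact_std_simplex]])
    show "(\<lambda>_. \<tau>) integrable_on std_simplex"
      by (rule set_lebesgue_integral_eq_integral(1)
          [OF continuous_imp_absolutely_integrable_on_compact[OF compact_std_simplex]]) simp
    fix s assume s: "s \<in> std_simplex"
    have N01: "0 \<le> N 0 s" "N 0 s < 1"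
      using N[OF _ s, of 0] \<delta> by (simp_all add: N_def)
    then have "(1 - N 0 s)^2 \<le> 1" "0 < (1 - N 0 s)^2" "0 < (1 - N 0 s)^3"
      by (simp_all add: power_le_one)
    \<comment> \<open>The density is at least 1, so as a factor it only makes the nonpositive \<tau>
      more negative.\<close>
    then have "\<tau> / (1 - N 0 s)^2 \<le> \<tau>"
      using \<open>\<tau> \<le> 0\<close> by (simp add: divide_le_eq mult_le_cancel_left1)
    moreover have "?T 0 * 2 * N' 0 s / (1 - N 0 s)^3 \<le> 0"
      using inner_lin3_nonpos[OF s inner] \<sigma> \<open>0 < (1 - N 0 s)^3\<close>
      by (intro divide_nonpos_pos mult_nonneg_nonpos) (auto simp: N'_def)
    ultimately show "\<phi>' 0 s \<le> \<tau>"
      unfolding \<phi>'_def by simp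
  qed
  moreover have "integral std_simplex (\<lambda>_. \<tau>) = \<tau> * measure lebesgue std_simplex"
    using lmeasure_integral[OF lmeasurable_compact[OF compact_std_simplex]]
      integral_mult_right[of std_simplex \<tau> "\<lambda>_. 1"] by simp
  ultimately show ?thesis by auto
qed

lemma measure_std_simplex_pos: "0 < measure lebesgue std_simplex"
proof -
  let ?B = "cbox (0 :: real^3) (\<chi> i. 1 / 3)"
  have "measure lebesgue ?B \<le> measure lebesgue std_simplex"
  proof (rule measure_mono_fmeasurable)
    show "?B \<subseteq> std_simplex"
      by (auto simp: mem_box_cart std_simplex_def forall_3)
  qed (auto intro: lmeasurable_compact compact_std_simplex)
  moreover have "0 < measure lebesgue ?B"
    using content_pos_lt[of "0 :: real^3" "\<chi> i. 1 / 3"]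
    by (auto simp: Basis_vec_def inner_axis)
  ultimately show ?thesis by linarith
qed

section \<open>Deformations of octahedral surfaces\<close>

lemma affine_independent_if_triple_nonzero:
  assumes "triple (b - a) (c - a) (d - a) \<noteq> 0"
  shows "\<not> affine_dependent {a, b, c, d}" and "card {a, b, c, d} = 4"
proof -
  have "triple x x y = 0" "triple x y x = 0" "triple y x x = 0" "triple 0 x y = 0" "triple x 0 y = 0"
    "triple x y 0 = 0" for x y
    by (simp_all add: triple_def algebra_simps)
  then have ne: "b \<noteq> a" "c \<noteq> a" "d \<noteq> a" "b \<noteq> c" "b \<noteq> d" "c \<noteq> d"
    using assms by auto
  then show "card {a, b, c, d} = 4" by simp
  let ?S = "{b - a, c - a, d - a}"
  have "independent ?S"
  proof (rule independent_if_scalars_zero)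
    fix f x assume f: "(\<Sum>x\<in>?S. f x *\<^sub>R x) = 0" and x: "x \<in> ?S"
    have "f (b - a) *\<^sub>R (b - a) + f (c - a) *\<^sub>R (c - a) + f (d - a) *\<^sub>R (d - a) = 0"
      using f ne by (simp add: add.assoc)
    from triple_nonzero_imp_independent[OF assms this] show "f x = 0"
      using x by auto
  qed simp
  moreover have "(\<lambda>x. - a + x) ` {b, c, d} = ?S" by (simp add: algebra_simps)
  ultimately show "\<not> affine_dependent {a, b, c, d}"
    using affine_dependent_iff_dependent[of a "{b, c, d}"] ne by simp
qed

lemma aff_dim_tetrahedron:
  fixes a b c d :: "real^3"
  assumes "triple (b - a) (c - a) (d - a) \<noteq> 0"
  shows "aff_dim {a, b, c, d} = 3"
  using aff_dim_affine_independent[OF affine_independent_if_triple_nonzero(1)[OF assms]]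
    affine_independent_if_triple_nonzero(2)[OF assms] by simp

text \<open>Together with the origin the three points span a genuine tetrahedron, and its faces
  inherit affine independence.\<close>

lemma aff_dim_triangle:
  fixes a b c :: "real^3"
  assumes "triple a b c \<noteq> 0"
  shows "aff_dim {a, b, c} = 2"
proof -
  have *: "\<not> affine_dependent {0, a, b, c}" "card {0, a, b, c} = 4"
    using affine_independent_if_triple_nonzero[of a 0 b c] assms by simp_all
  then have "\<not> affine_dependent {a, b, c}"
    using affine_independent_subset by blast
  moreover have "card {a, b, c} = 3"
    using *(2) by (auto simp: card_insert_if split: if_splits)
  ultimately show ?thesis
    using aff_dim_affine_independent[of "{a, b, c}"] by simp
qed

text \<open>The two faces at an edge have as further vertices an opposite pair, so each edge of the
  octahedron is tested by the volume of the tetrahedron that it spans with that pair.\<close>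

definition edges_not_flat :: "(nat \<Rightarrow> real^3) \<Rightarrow> bool" where
  "edges_not_flat p \<longleftrightarrow>
     (\<forall>j\<in>{1, 4}. \<forall>k\<in>{2, 5}. triple (p 3 - p 0) (p j - p 0) (p k - p 0) \<noteq> 0) \<and>
     (\<forall>i\<in>{0, 3}. \<forall>k\<in>{2, 5}. triple (p 4 - p 1) (p i - p 1) (p k - p 1) \<noteq> 0) \<and>
     (\<forall>i\<in>{0, 3}. \<forall>j\<in>{1, 4}. triple (p 5 - p 2) (p i - p 2) (p j - p 2) \<noteq> 0)"

lemma polyhedral_surface_octahedron:
  assumes pos: "positively_oriented p" and norm: "\<And>v. v < 6 \<Longrightarrow> norm (p v) < 1"
    and flat: "edges_not_flat p"
  shows "polyhedral_surface octahedron_faces p"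
  unfolding polyhedral_surface_def
proof (intro conjI ballI impI)
  show "finite octahedron_faces" by (simp add: octahedron_faces_def)
next
  fix A assume "A \<in> octahedron_faces"
  then obtain i j k where A: "A = {i, j, k}" and ijk: "i \<in> {0, 3}" "j \<in> {1, 4}" "k \<in> {2, 5}"
    unfolding octahedron_faces_iff by blast
  have "i \<noteq> j" "i \<noteq> k" "j \<noteq> k" using ijk by auto
  then show "card A = 3" unfolding A by simp
  have "i < 6" "j < 6" "k < 6" using ijk by auto
  then show "p ` A \<subseteq> klein_ball" unfolding A klein_ball_def using norm by simp
  have "triple (p i) (p j) (p k) \<noteq> 0"
    using positively_oriented_triple[OF pos ijk] by (metis less_irrefl mult_zero_right)
  then show "aff_dim (p ` A) = 2"
    unfolding A by (simp add: aff_dim_triangle)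
next
  fix A B assume "A \<in> octahedron_faces" "B \<in> octahedron_faces" and card: "card (A \<inter> B) = 2"
  then obtain i j k i' j' k' where A: "A = {i, j, k}" and ijk: "i \<in> {0, 3}" "j \<in> {1, 4}" "k \<in> {2, 5}"
    and B: "B = {i', j', k'}" and ijk': "i' \<in> {0, 3}" "j' \<in> {1, 4}" "k' \<in> {2, 5}"
    unfolding octahedron_faces_iff by blast
  have ne: "i \<noteq> j" "i \<noteq> k" "j \<noteq> k" using ijk by auto
  have ne': "i \<noteq> j'" "i \<noteq> k'" "j \<noteq> i'" "j \<noteq> k'" "k \<noteq> i'" "k \<noteq> j'"
    using ijk ijk' by auto
  have small: "card X \<noteq> 2" if "X \<subseteq> {x}" for X and x :: nat
    using card_mono[OF _ that] by simp
  \<comment> \<open>If two of the three positions differed, the intersection would lie in the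
    singleton of the third. So exactly one position differs.\<close>
  have "i = i' \<or> j = j'" "i = i' \<or> k = k'" "j = j' \<or> k = k'"
    using small[of "A \<inter> B" k] small[of "A \<inter> B" j] small[of "A \<inter> B" i] card ne'
    unfolding A B by auto
  moreover have "\<not> (i = i' \<and> j = j' \<and> k = k')"
    using card ne unfolding A B by auto
  ultimately consider "i \<noteq> i'" "j = j'" "k = k'" | "i = i'" "j \<noteq> j'" "k = k'" | "i = i'" "j = j'" "k \<noteq> k'"
    by blast
  then show "aff_dim (p ` (A \<union> B)) = 3"
  proof cases
    case 1
    then have "{i, i'} = {0, 3}" using ijk(1) ijk'(1) by auto
    moreover have "A \<union> B = {i, i'} \<union> {j, k}" using 1 by (auto simp: A B)
    ultimately have "A \<union> B = {0, 3, j, k}" by (simp add: insert_commute)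
    moreover have "triple (p 3 - p 0) (p j - p 0) (p k - p 0) \<noteq> 0"
      using flat ijk unfolding edges_not_flat_def by blast
    ultimately show ?thesis by (simp add: aff_dim_tetrahedron)
  next
    case 2
    then have "{j, j'} = {1, 4}" using ijk(2) ijk'(2) by auto
    moreover have "A \<union> B = {j, j'} \<union> {i, k}" using 2 by (auto simp: A B)
    ultimately have "A \<union> B = {1, 4, i, k}" by (simp add: insert_commute)
    moreover have "triple (p 4 - p 1) (p i - p 1) (p k - p 1) \<noteq> 0"
      using flat ijk unfolding edges_not_flat_def by blast
    ultimately show ?thesis by (simp add: aff_dim_tetrahedron)
  next
    case 3
    then have "{k, k'} = {2, 5}" using ijk(3) ijk'(3) by auto
    moreover have "A \<union> B = {k, k'} \<union> {i, j}" using 3 by (auto simp: A B)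
    ultimately have "A \<union> B = {2, 5, i, j}" by (simp add: insert_commute)
    moreover have "triple (p 5 - p 2) (p i - p 2) (p j - p 2) \<noteq> 0"
      using flat ijk unfolding edges_not_flat_def by blast
    ultimately show ?thesis by (simp add: aff_dim_tetrahedron)
  qed
qed

section \<open>Persistence of open conditions for small parameters\<close>

lemma eventually_positive_near_0:
  fixes f :: "real \<Rightarrow> real"
  assumes "continuous_on UNIV f" "0 < f 0"
  shows "\<forall>\<^sub>F t in nhds 0. 0 < f t"
  using eventually_nhds_in_open[of "{t. 0 < f t}" 0] assms
  by (simp add: open_Collect_less)

lemma eventually_nonzero_near_0:
  fixes f :: "real \<Rightarrow> real"
  assumes "continuous_on UNIV f" "f 0 \<noteq> 0"
  shows "\<forall>\<^sub>F t in nhds 0. f t \<noteq> 0"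
  using eventually_nhds_in_open[of "{t. f t \<noteq> 0}" 0] assms
  by (simp add: open_Collect_neq)

lemma eventually_positively_oriented:
  assumes "positively_oriented p"
  shows "\<forall>\<^sub>F t in nhds 0. positively_oriented (\<lambda>v. p v + t *\<^sub>R w v)"
  unfolding positively_oriented_def ball_simps
  using assms
  by (auto simp: positively_oriented_def
      intro!: eventually_conj eventually_positive_near_0 continuous_intros)

lemma eventually_edges_not_flat:
  assumes "edges_not_flat p"
  shows "\<forall>\<^sub>F t in nhds 0. edges_not_flat (\<lambda>v. p v + t *\<^sub>R w v)"
  unfolding edges_not_flat_def
  using assms
  by (auto simp: edges_not_flat_def
      intro!: eventually_conj eventually_nonzero_near_0 continuous_intros)

lemma eventually_norm_less_1:
  fixes p w :: "nat \<Rightarrow> real^3"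
  assumes "\<And>v. v < n \<Longrightarrow> norm (p v) < 1"
  shows "\<forall>\<^sub>F t in nhds 0. \<forall>v<n. norm (p v + t *\<^sub>R w v) < 1"
proof -
  have "\<forall>\<^sub>F t in nhds 0. norm (p v + t *\<^sub>R w v) < 1" if "v < n" for v
    using eventually_positive_near_0[of "\<lambda>t. 1 - norm (p v + t *\<^sub>R w v)"] assms[OF that]
    by (simp add: continuous_intros)
  then have "\<forall>\<^sub>F t in nhds 0. \<forall>v\<in>{..<n}. norm (p v + t *\<^sub>R w v) < 1"
    by (intro eventually_ball_finite) auto
  then show ?thesis by (rule eventually_mono) simp
qed

lemma real_analytic_on_affine: "real_analytic_on (\<lambda>t. a + t *\<^sub>R b) S"
  unfolding real_analytic_on_def
proof (intro ballI exI[of _ 1] conjI allI impI)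
  fix s :: real
  show "\<exists>c. \<forall>t. \<bar>t - s\<bar> < 1 \<longrightarrow> (\<lambda>n. (t - s) ^ n *\<^sub>R c n) sums (a + t *\<^sub>R b)"
  proof (intro exI allI impI)
    fix t
    let ?c = "\<lambda>n :: nat. if n = 0 then a + s *\<^sub>R b else if n = 1 then b else 0"
    have "(\<lambda>n. (t - s) ^ n *\<^sub>R ?c n) sums (\<Sum>n\<in>{0, 1}. (t - s) ^ n *\<^sub>R ?c n)"
      by (rule sums_finite) auto
    then show "(\<lambda>n. (t - s) ^ n *\<^sub>R ?c n) sums (a + t *\<^sub>R b)"
      by (simp add: algebra_simps)
  qed
qed simp

text \<open>\<open>flex\<close> is the vanishing of the derivative of the quotient inside
  \<open>arcosh\<close>, cleared of denominators. \<open>far\<close> places that quotient above 1 at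
  time 0, where \<open>arcosh\<close> is differentiable.\<close>

lemma stationary_hyp_dist:
  fixes x y x' y' :: "real^3"
  assumes norm: "norm x < 1" "norm y < 1"
    and far: "(1 - x \<bullet> x) * (1 - y \<bullet> y) < (1 - x \<bullet> y)\<^sup>2"
    and flex: "(x' \<bullet> y + x \<bullet> y') * ((1 - x \<bullet> x) * (1 - y \<bullet> y))
      = (1 - x \<bullet> y) * ((x \<bullet> x') * (1 - y \<bullet> y) + (y \<bullet> y') * (1 - x \<bullet> x))"
  shows "stationary (\<lambda>t. hyp_dist (x + t *\<^sub>R x') (y + t *\<^sub>R y'))"
proof -
  define A where "A t = 1 - (x + t *\<^sub>R x') \<bullet> (y + t *\<^sub>R y')" for t
  define M where "M t = (1 - (x + t *\<^sub>R x') \<bullet> (x + t *\<^sub>R x')) * (1 - (y + t *\<^sub>R y') \<bullet> (y + t *\<^sub>R y'))" for t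
  have less: "x \<bullet> x < 1" "y \<bullet> y < 1"
    using norm by (simp_all add: dot_square_norm power_less_one_iff)
  then have M0: "0 < M 0" by (simp add: M_def)
  have "x \<bullet> y \<le> norm x * norm y" by (rule norm_cauchy_schwarz)
  also have "\<dots> < 1" using norm mult_le_less_imp_less[of "norm x" 1 "norm y" 1] by (smt (verit) mult_left_le norm_ge_zero)
  finally have A0: "0 < A 0" by (simp add: A_def)
  have sq: "sqrt (M 0) < A 0"
    using far A0 M0 by (intro real_less_lsqrt) (simp_all add: A_def M_def)
  have A_eq: "A t = (1 - x \<bullet> y) - t * (x' \<bullet> y + x \<bullet> y') - t^2 * (x' \<bullet> y')" for t
    by (simp add: A_def inner_simps algebra_simps power2_eq_square)
  have M_eq: "M t = ((1 - x \<bullet> x) - 2 * t * (x \<bullet> x') - t^2 * (x' \<bullet> x'))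
      * ((1 - y \<bullet> y) - 2 * t * (y \<bullet> y') - t^2 * (y' \<bullet> y'))" for t
    by (simp add: M_def inner_simps inner_commute algebra_simps power2_eq_square)
  have A': "(A has_real_derivative - (x' \<bullet> y + x \<bullet> y')) (at 0)"
    unfolding A_eq[abs_def] by (auto intro!: derivative_eq_intros)
  define M' where "M' = - 2 * (x \<bullet> x') * (1 - y \<bullet> y) - 2 * (y \<bullet> y') * (1 - x \<bullet> x)"
  have M': "(M has_real_derivative M') (at 0)"
    unfolding M_eq[abs_def] M'_def by (auto intro!: derivative_eq_intros simp: algebra_simps)
  have "((\<lambda>t. A t / sqrt (M t)) has_real_derivative
      (- (x' \<bullet> y + x \<bullet> y') * sqrt (M 0) - A 0 * (M' * (inverse (sqrt (M 0)) / 2))) / (sqrt (M 0) * sqrt (M 0))) (at 0)"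
    using M0 by (auto intro!: derivative_eq_intros A' M')
  moreover have "- (x' \<bullet> y + x \<bullet> y') * sqrt (M 0) - A 0 * (M' * (inverse (sqrt (M 0)) / 2)) = 0"
  proof -
    have "(- c * r - A 0 * (M' * (inverse r / 2))) * r = - c * (r * r) - A 0 * M' / 2" if "0 < r" for c r
      using that by (simp add: field_simps)
    from this[of "sqrt (M 0)" "x' \<bullet> y + x \<bullet> y'"] M0
    have "(- (x' \<bullet> y + x \<bullet> y') * sqrt (M 0) - A 0 * (M' * (inverse (sqrt (M 0)) / 2))) * sqrt (M 0)
        = - (x' \<bullet> y + x \<bullet> y') * M 0 - A 0 * M' / 2" by simp
    also have "\<dots> = 0"
    proof -
      have *: "S * m = a * E \<Longrightarrow> - S * m - a * (- 2 * E) / 2 = 0" for S m a E :: real by simp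
      have M'_alt: "M' = - 2 * ((x \<bullet> x') * (1 - y \<bullet> y) + (y \<bullet> y') * (1 - x \<bullet> x))"
        by (simp add: M'_def algebra_simps)
      show ?thesis unfolding M'_alt by (rule *) (use flex in \<open>simp add: A_def M_def\<close>)
    qed
    finally show ?thesis using M0 by simp
  qed
  ultimately have "((\<lambda>t. A t / sqrt (M t)) has_real_derivative 0) (at 0)" by (simp only: div_0)
  moreover have "1 < A 0 / sqrt (M 0)"
    using sq M0 by simp
  ultimately have "((\<lambda>t. arcosh (A t / sqrt (M t))) has_real_derivative 0) (at 0)"
    using DERIV_chain2[OF arcosh_real_has_field_derivative] by fastforce
  then show ?thesis
    unfolding stationary_def hyp_dist_def A_def M_def by (simp add: dot_square_norm)
qed

text \<open>For a positively oriented octahedron this is six times the rate of change of the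
  Euclidean volume of one of the eight tetrahedra.\<close>

definition oriented_triple_deriv ::
    "(nat \<Rightarrow> real^3) \<Rightarrow> (nat \<Rightarrow> real^3) \<Rightarrow> nat \<Rightarrow> nat \<Rightarrow> nat \<Rightarrow> real" where
  "oriented_triple_deriv p w i j k = orthant_sign i j k *
     (triple (w i) (p j) (p k) + triple (p i) (w j) (p k) + triple (p i) (p j) (w k))"

text \<open>The tetrahedra are estimated one by one, and strictness is needed only for the sum. The
  case \<open>u = v\<close> of \<open>inner\<close> is the condition on the distances of the
  vertices to the origin.\<close>

lemma bounded_volume_octahedron_decreasing:
  assumes pos: "positively_oriented p" and norm: "\<And>v. v < 6 \<Longrightarrow> norm (p v) < 1"
    and inner: "\<And>u v. u < 6 \<Longrightarrow> v < 6 \<Longrightarrow> u \<noteq> v + 3 \<Longrightarrow> v \<noteq> u + 3 \<Longrightarrow> p u \<bullet> w v + p v \<bullet> w u \<le> 0"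
    and nonpos: "\<And>i j k. i \<in> {0, 3} \<Longrightarrow> j \<in> {1, 4} \<Longrightarrow> k \<in> {2, 5} \<Longrightarrow> oriented_triple_deriv p w i j k \<le> 0"
    and neg: "(\<Sum>(i, j, k)\<in>orthants. oriented_triple_deriv p w i j k) < 0"
  shows "\<exists>D<0. ((\<lambda>t. bounded_volume octahedron_faces (\<lambda>v. p v + t *\<^sub>R w v)) has_real_derivative D) (at 0)"
proof -
  let ?q = "\<lambda>t v. p v + t *\<^sub>R w v"
  let ?f = "\<lambda>t (i, j, k). tetra_volume (?q t i) (?q t j) (?q t k)"
  define P where "P a D \<longleftrightarrow> ((\<lambda>t. ?f t a) has_real_derivative D) (at 0)
      \<and> D \<le> (case a of (i, j, k) \<Rightarrow> oriented_triple_deriv p w i j k) * measure lebesgue std_simplex" for a D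
  have "\<exists>D. P a D" if a_in: "a \<in> orthants" for a
  proof -
    obtain i j k where a: "a = (i, j, k)" and ijk: "i \<in> {0, 3}" "j \<in> {1, 4}" "k \<in> {2, 5}"
      using a_in unfolding orthants_def by blast
    have lt: "i < 6" "j < 6" "k < 6" using ijk by auto
    have "i \<noteq> j + 3" "j \<noteq> i + 3" using ijk(1,2) by auto
    moreover have "i \<noteq> k + 3" "k \<noteq> i + 3" using ijk(1,3) by auto
    moreover have "j \<noteq> k + 3" "k \<noteq> j + 3" using ijk(2,3) by auto
    ultimately have in6: "p i \<bullet> w i \<le> 0" "p j \<bullet> w j \<le> 0" "p k \<bullet> w k \<le> 0"
      "p i \<bullet> w j + p j \<bullet> w i \<le> 0" "p i \<bullet> w k + p k \<bullet> w i \<le> 0" "p j \<bullet> w k + p k \<bullet> w j \<le> 0"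
      using inner[of i i] inner[of j j] inner[of k k] inner[of i j] inner[of i k] inner[of j k] lt by simp_all
    have "orthant_sign i j k \<in> {-1, 1}" by (simp add: orthant_sign_def)
    moreover have "0 < orthant_sign i j k * triple (p i) (p j) (p k)"
      by (rule positively_oriented_triple[OF pos ijk])
    ultimately show ?thesis
      using tetra_volume_along_line_deriv[OF norm[OF lt(1)] norm[OF lt(2)] norm[OF lt(3)] _ _ oriented_triple_deriv_def nonpos[OF ijk] in6]
      unfolding P_def a prod.case by blast
  qed
  then have "\<forall>a\<in>orthants. \<exists>D. P a D" by blast
  then obtain D where "\<forall>a\<in>orthants. P a (D a)" using bchoice[of orthants P] by blast
  then have D: "((\<lambda>t. ?f t a) has_real_derivative D a) (at 0)"
    "D a \<le> (case a of (i, j, k) \<Rightarrow> oriented_triple_deriv p w i j k) * measure lebesgue std_simplex" if "a \<in> orthants" for a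
    using that unfolding P_def by blast+
  have "((\<lambda>t. sum (?f t) orthants) has_real_derivative sum D orthants) (at 0)"
    by (intro DERIV_sum D)
  \<comment> \<open>The sum formula is available only while the octahedron stays positively oriented
    in the ball, which suffices for a derivative at 0.\<close>
  moreover have "\<forall>\<^sub>F t in nhds 0. \<forall>v<6. norm (?q t v) < 1"
    by (rule eventually_norm_less_1) (rule norm)
  then have "\<forall>\<^sub>F t in nhds 0. bounded_volume octahedron_faces (?q t) = sum (?f t) orthants"
    using eventually_positively_oriented[OF pos, of w]
  proof eventually_elim
    case (elim t)
    then show ?case
      by (simp only: bounded_volume_octahedron hyp_volume_pl_map_l1_ball)
  qed
  ultimately have "((\<lambda>t. bounded_volume octahedron_faces (?q t)) has_real_derivative sum D orthants) (at 0)"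
    by (subst DERIV_cong_ev[OF refl _ refl]) auto
  moreover have "sum D orthants \<le> (\<Sum>a\<in>orthants. (case a of (i, j, k) \<Rightarrow> oriented_triple_deriv p w i j k) * measure lebesgue std_simplex)"
    by (intro sum_mono D)
  then have "sum D orthants \<le> (\<Sum>(i, j, k)\<in>orthants. oriented_triple_deriv p w i j k) * measure lebesgue std_simplex"
    by (simp only: sum_distrib_right)
  with neg measure_std_simplex_pos have "sum D orthants < 0"
    by (meson le_less_trans mult_neg_pos)
  ultimately show ?thesis by blast
qed

section \<open>The flexible octahedron\<close>

text \<open>A cyclic permutation of the coordinates permutes the vertices 0, 1, 2 and the vertices 3, 4, 5.
  Around the axis spanned by (1,1,1), opposite vertices stand at a right angle, which is the position
  in which a twisted octahedron with this symmetry becomes infinitesimally flexible; the second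
  triangle is \<open>\<surd>3\<close> times as large as the first in order to make the coordinates rational.
  The flex is normalized by an infinitesimal isometry such that the vertices 3, 4, 5 rest.\<close>

definition twisted_octahedron :: "nat \<Rightarrow> real^3" where
  "twisted_octahedron v =
     (if v = 0 then vector [0, 1/2, 1/2] else if v = 1 then vector [1/2, 0, 1/2]
      else if v = 2 then vector [1/2, 1/2, 0] else if v = 3 then vector [-1/4, -3/4, 1/4]
      else if v = 4 then vector [1/4, -1/4, -3/4] else vector [-3/4, 1/4, -1/4])"

text \<open>With e = (1,1,1), the velocity at a vertex x among 0, 1, 2 is (x . e) x - e + 7 (e
  \<times> x): a hyperbolic translation along the axis plus a rotation about it, so this triangle
  moves rigidly to first order. The six remaining edges form two orbits of the cyclic symmetry, each
  giving one linear equation between the speeds of translation and rotation. Because of the right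
  angle the two equations agree, and they yield the factor 7.\<close>

definition twist_velocity :: "nat \<Rightarrow> real^3" where
  "twist_velocity v =
     (if v = 0 then vector [-1, -4, 3] else if v = 1 then vector [3, -1, -4]
      else if v = 2 then vector [-4, 3, -1] else 0)"

lemma less_6_cases: "v < 6 \<longleftrightarrow> v = 0 \<or> v = 1 \<or> v = 2 \<or> v = 3 \<or> v = 4 \<or> v = (5 :: nat)"
  by auto

lemma inner_real_3:
  fixes x y :: "real^3"
  shows "x \<bullet> y = x$1 * y$1 + x$2 * y$2 + x$3 * y$3"
  by (simp add: inner_vec_def sum_3)

lemma twisted_octahedron_oriented: "positively_oriented twisted_octahedron"
  by (simp add: positively_oriented_def twisted_octahedron_def triple_def)

lemma twisted_octahedron_not_flat: "edges_not_flat twisted_octahedron"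
  by (simp add: edges_not_flat_def twisted_octahedron_def triple_def)

lemma norm_twisted_octahedron: "norm (twisted_octahedron v) < 1"
  by (simp add: twisted_octahedron_def norm_eq_sqrt_inner inner_real_3)

text \<open>The stationarity condition is homogeneous in the velocities, so it survives the factor
  \<open>d\<close> by which the motion is later rescaled.\<close>

lemma twisted_octahedron_edges:
  assumes "u < 6" "v < 6" "u \<noteq> v + 3" "v \<noteq> u + 3"
  shows "twisted_octahedron u \<bullet> twist_velocity v + twisted_octahedron v \<bullet> twist_velocity u \<le> 0"
    and "u \<noteq> v \<Longrightarrow> stationary (\<lambda>t. hyp_dist (twisted_octahedron u + t *\<^sub>R (d *\<^sub>R twist_velocity u))
      (twisted_octahedron v + t *\<^sub>R (d *\<^sub>R twist_velocity v)))"
proof -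
  show "twisted_octahedron u \<bullet> twist_velocity v + twisted_octahedron v \<bullet> twist_velocity u \<le> 0"
    using assms unfolding less_6_cases
    by (elim disjE; simp add: twisted_octahedron_def twist_velocity_def inner_real_3)
  assume "u \<noteq> v"
  then show "stationary (\<lambda>t. hyp_dist (twisted_octahedron u + t *\<^sub>R (d *\<^sub>R twist_velocity u))
      (twisted_octahedron v + t *\<^sub>R (d *\<^sub>R twist_velocity v)))"
    using assms unfolding less_6_cases
    by (intro stationary_hyp_dist norm_twisted_octahedron)
      (elim disjE; simp add: twisted_octahedron_def twist_velocity_def inner_real_3 power2_eq_square)+
qed

lemma sum_orthants:
  "(\<Sum>(i, j, k)\<in>orthants. f i j k) = (\<Sum>i\<in>{0, 3}. \<Sum>j\<in>{1, 4}. \<Sum>k\<in>{2, 5}. f i j k)"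
  by (simp only: orthants_def sum.cartesian_product)

text \<open>The tetrahedra over the faces 0, 1, 2 and 3, 4, 5 keep their Euclidean volume to first
  order. The other six strictly lose volume, with \<open>oriented_triple_deriv\<close> equal to
  -27/8 for three of them and -25/8 for the other three.\<close>

lemma twisted_octahedron_volume_decreasing:
  "\<exists>D<0. ((\<lambda>t. bounded_volume octahedron_faces
      (\<lambda>v. twisted_octahedron v + t *\<^sub>R twist_velocity v)) has_real_derivative D) (at 0)"
proof (rule bounded_volume_octahedron_decreasing[OF twisted_octahedron_oriented norm_twisted_octahedron
      twisted_octahedron_edges(1)])
  fix i j k :: nat assume "i \<in> {0, 3}" "j \<in> {1, 4}" "k \<in> {2, 5}"
  then show "oriented_triple_deriv twisted_octahedron twist_velocity i j k \<le> 0"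
    unfolding oriented_triple_deriv_def orthant_sign_def
    by (elim insertE emptyE; simp add: twisted_octahedron_def twist_velocity_def triple_def)
qed (simp_all add: sum_orthants oriented_triple_deriv_def orthant_sign_def twisted_octahedron_def twist_velocity_def triple_def)

theorem mainTheorem1:
  shows "\<exists>(F :: nat set set) (p :: nat \<Rightarrow> real^3) (P :: real \<Rightarrow> nat \<Rightarrow> real^3).
    polyhedral_surface F p \<and>
    homeomorphic_to_sphere F p \<and>
    no_self_intersections F p \<and>
    infinitesimal_flex F p P \<and>
    (\<exists>D. ((\<lambda>t. bounded_volume F (P t)) has_real_derivative D) (at 0) \<and> D \<noteq> 0)"
proof -
  let ?q = "\<lambda>t v. twisted_octahedron v + t *\<^sub>R twist_velocity v"
  have "\<forall>\<^sub>F t in nhds 0. \<forall>v<6. norm (?q t v) < 1"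
    by (rule eventually_norm_less_1) (rule norm_twisted_octahedron)
  then have "\<forall>\<^sub>F t in nhds 0. polyhedral_surface octahedron_faces (?q t)"
    using eventually_positively_oriented[OF twisted_octahedron_oriented, of twist_velocity]
      eventually_edges_not_flat[OF twisted_octahedron_not_flat, of twist_velocity]
    by eventually_elim (auto intro: polyhedral_surface_octahedron)
  then obtain d where d: "0 < d" "\<And>t. dist t 0 < d \<Longrightarrow> polyhedral_surface octahedron_faces (?q t)"
    unfolding eventually_nhds_metric by blast
  \<comment> \<open>For parameters in (-1,1) the rescaled time stays below the radius
    \<open>d\<close> within which the surface is polyhedral. The derivative of the volume is merely
    multiplied by the positive \<open>d\<close>.\<close>
  define P where "P t v = twisted_octahedron v + t *\<^sub>R (d *\<^sub>R twist_velocity v)" for t v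
  have surface: "polyhedral_surface octahedron_faces (P t)" if "\<bar>t\<bar> < 1" for t
    using d(2)[of "t * d"] that d(1) by (simp add: P_def[abs_def] abs_mult)
  have P0: "P 0 = twisted_octahedron" by (simp add: P_def fun_eq_iff)
  have stat: "stationary (\<lambda>t. hyp_dist (P t u) (P t v))" if uv: "edge octahedron_faces u v" for u v
  proof -
    obtain A where A: "A \<in> octahedron_faces" "u \<in> A" "v \<in> A" "u \<noteq> v"
      using uv unfolding edge_def by blast
    have "u < 6" "v < 6"
      using octahedron_face_no_opposite(1)[OF A(1)] A(2,3) by auto
    moreover have "u \<noteq> v + 3" "v \<noteq> u + 3"
      using octahedron_face_no_opposite(2)[OF A(1)] A(2,3) by metis+
    ultimately show ?thesis
      using twisted_octahedron_edges(2) A(4) unfolding P_def by blast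
  qed
  have "infinitesimal_flex octahedron_faces twisted_octahedron P"
    unfolding infinitesimal_flex_def deformation_def
  proof (intro conjI ballI allI impI)
    show "real_analytic_on (\<lambda>t. P t v) {-1<..<1}" for v
      unfolding P_def by (rule real_analytic_on_affine)
  qed (auto simp: P0 intro: surface stat)
  moreover have "\<exists>D. ((\<lambda>t. bounded_volume octahedron_faces (P t)) has_real_derivative D) (at 0) \<and> D \<noteq> 0"
  proof -
    obtain D where D: "D < 0" "((\<lambda>t. bounded_volume octahedron_faces (?q t)) has_real_derivative D) (at 0)"
      using twisted_octahedron_volume_decreasing by blast
    have "((\<lambda>t. bounded_volume octahedron_faces (?q (t * d))) has_real_derivative D * d) (at 0)"
      by (rule DERIV_chain2[where g = "\<lambda>t. t * d"]) (use D in \<open>auto intro!: derivative_eq_intros\<close>)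
    then show ?thesis
      using D(1) d(1) by (intro exI[of _ "D * d"]) (simp add: P_def[abs_def])
  qed
  moreover have "polyhedral_surface octahedron_faces twisted_octahedron"
    using surface[of 0] by (simp add: P0)
  ultimately show ?thesis
    using homeomorphic_to_sphere_octahedron[OF twisted_octahedron_oriented]
      no_self_intersections_octahedron[OF twisted_octahedron_oriented]
    by blast
qed

end
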